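(* For every instance $\mathbb I=(\mathcal M_1,\dots,\mathcal M_n,\mathcal F)$ of matroid-min-CICS, $$\mathrm{OPT}(\mathbb I)\ \ge\ \mathbb E\Big[\min_{S\in\mathcal F}\sum_{i\in S}W^*_{\mathcal M_i}\Big],$$ where $W^*_{\mathcal M_1},\dots,W^*_{\mathcal M_n}$ are mutually independent.
   Context: A costly information MDP is $\mathcal M=(S,\sigma,A,c,\mathcal D,V,T)$: a finite state set $S$, start state $\sigma$, terminal states $T\subseteq S$, for each nonterminal $s$ a finite nonempty action set $A(s)$, each action $a$ with cost $c(a)\ge0$ and transition distribution $\mathcal D(s,a,\cdot)$; $V(s)$ is the conditional distribution of an underlying nonnegative random variable given state $s$, $v(s)=\mathbb E[V(s)]$. At a terminal state the only action is "accept" (cost $0$, yields value $v(t)$, ends the process). The transition graph is acyclic and every sequence of $H$ actions (fixed $H$) reaches a terminal state. Matroid-min-CICS: an instance consists of $n$ independently evolving costly information MDPs $\mathcal M_1,\dots,\mathcal M_n$ and a matroid on $[n]$; $\mathcal F$ is the family of subsets of $[n]$ containing a basis. A policy keeps the current state of each MDP and the set $S$ of accepted indices; at each step it adaptively (possibly randomly) picks $i\notin S$ and an action in the current state of $\mathcal M_i$, pays its cost, and $\mathcal M_i$ transitions (others unchanged); accepting a terminal state adds $i$ to $S$ and incurs its value. It stops as soon as $S\in\mathcal F$. The cost is total action costs plus accepted values; $\mathrm{OPT}(\mathbb I)$ is the minimum expected cost. Local game and surrogate cost: for $y\in\mathbb R$, in the local game $(\mathcal M,y)$ a policy advances $\mathcal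 M$ for some number of steps and then either accepts an outside option of deterministic cost $y$ or accepts a terminal state of $\mathcal M$; $f_{\mathcal M}(y)$ is the minimum expected total cost (action costs plus accepted cost). The water filling surrogate cost $W^*_{\mathcal M}$ is the random variable with $\mathbb E[\min(y,W^*_{\mathcal M})]=f_{\mathcal M}(y)$ for all $y\in\mathbb R$. *)

theory Defs
  imports "HOL-Probability.Probability"
begin

section \<open>Costly information MDPs\<close>

record ('s, 'a) cimdp =
  states :: "'s set"
  start :: 's
  actions :: "'s \<Rightarrow> 'a set"
  cost :: "'a \<Rightarrow> real"
  trans :: "'s \<Rightarrow> 'a \<Rightarrow> 's pmf"
  val_dist :: "'s \<Rightarrow> real measure"
  terminals :: "'s set"

definition mean_val :: "('s, 'a) cimdp \<Rightarrow> 's \<Rightarrow> real" where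
  "mean_val M s = (\<integral>x. x \<partial>val_dist M s)"

definition edges :: "('s, 'a) cimdp \<Rightarrow> ('s \<times> 's) set" where
  "edges M = {(s, s'). s \<in> states M - terminals M \<and> (\<exists>a\<in>actions M s. s' \<in> set_pmf (trans M s a))}"

text \<open>
  The last clause expresses that the value distributions are the conditional distributions of one
  underlying random variable given the current state: whichever action is taken, the distribution
  at a state is the mixture of the distributions at its successors (law of total probability).
  It is only demanded at states that can occur, since conditioning is meaningless elsewhere.
\<close>

definition costly_information_mdp :: "('s, 'a) cimdp \<Rightarrow> bool" where
  "costly_information_mdp M \<longleftrightarrow>
     finite (states M) \<and> start M \<in> states M \<and> terminals M \<subseteq> states M \<and>
     (\<forall>s\<in>states M - terminals M. finite (actions M s) \<and> actions M s \<noteq> {} \<and>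
        (\<forall>a\<in>actions M s. 0 \<le> cost M a \<and> set_pmf (trans M s a) \<subseteq> states M)) \<and>
     acyclic (edges M) \<and>
     (\<exists>H. \<forall>s. (start M, s) \<in> edges M ^^ H \<longrightarrow> s \<in> terminals M) \<and>
     (\<forall>s\<in>states M. prob_space (val_dist M s) \<and> sets (val_dist M s) = sets borel \<and>
        (AE x in val_dist M s. 0 \<le> x) \<and> integrable (val_dist M s) (\<lambda>x. x)) \<and>
     (\<forall>s\<in>states M - terminals M. (start M, s) \<in> (edges M)\<^sup>* \<longrightarrow> (\<forall>a\<in>actions M s. \<forall>B\<in>sets borel.
        measure (val_dist M s) B =
          (\<Sum>s'\<in>states M. pmf (trans M s a) s' * measure (val_dist M s') B)))"

datatype 'a act = Advance 'a | Accept

definition acts :: "('s, 'a) cimdp \<Rightarrow> 's \<Rightarrow> 'a act set" where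
  "acts M s = (if s \<in> terminals M then {Accept} else Advance ` actions M s)"

primrec act_cost :: "('s, 'a) cimdp \<Rightarrow> 's \<Rightarrow> 'a act \<Rightarrow> real" where
  "act_cost M s (Advance a) = cost M a"
| "act_cost M s Accept = mean_val M s"

section \<open>Sequential decision problems\<close>

text \<open>
  A decision problem is over exactly when no move is legal. A policy is randomised and may depend
  on the whole history, which consists of the past positions and moves (latest first) together
  with the current position.
\<close>

record ('c, 'm) game =
  init :: 'c
  legal :: "'c \<Rightarrow> 'm set"
  price :: "'c \<Rightarrow> 'm \<Rightarrow> real"
  succ :: "'c \<Rightarrow> 'm \<Rightarrow> 'c pmf"

type_synonym ('c, 'm) history = "('c \<times> 'm) list \<times> 'c"
type_synonym ('c, 'm) policy = "('c, 'm) history \<Rightarrow> 'm pmf"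

definition play_step ::
    "('c, 'm) game \<Rightarrow> ('c, 'm) policy \<Rightarrow> ('c, 'm) history \<Rightarrow> ('c, 'm) history pmf" where
  "play_step G \<pi> = (\<lambda>(h, c).
     if legal G c = {} then return_pmf (h, c)
     else bind_pmf (\<pi> (h, c)) (\<lambda>m. map_pmf (\<lambda>c'. ((c, m) # h, c')) (succ G c m)))"

primrec play :: "('c, 'm) game \<Rightarrow> ('c, 'm) policy \<Rightarrow> nat \<Rightarrow> ('c, 'm) history pmf" where
  "play G \<pi> 0 = return_pmf ([], init G)"
| "play G \<pi> (Suc k) = bind_pmf (play G \<pi> k) (play_step G \<pi>)"

definition admissible :: "('c, 'm) game \<Rightarrow> ('c, 'm) policy \<Rightarrow> bool" where
  "admissible G \<pi> \<longleftrightarrow>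
     (\<forall>k. \<forall>(h, c)\<in>set_pmf (play G \<pi> k). legal G c \<noteq> {} \<longrightarrow> set_pmf (\<pi> (h, c)) \<subseteq> legal G c)"

definition total_price :: "('c, 'm) game \<Rightarrow> ('c, 'm) history \<Rightarrow> real" where
  "total_price G = (\<lambda>(h, c). \<Sum>(d, m)\<leftarrow>h. price G d m)"

text \<open>
  In the games below, an admissible policy ends the game within a bounded number of steps, so the
  sequence of expectations is eventually constant.
\<close>

definition expected_cost :: "('c, 'm) game \<Rightarrow> ('c, 'm) policy \<Rightarrow> real" where
  "expected_cost G \<pi> = lim (\<lambda>k. measure_pmf.expectation (play G \<pi> k) (total_price G))"

definition min_cost :: "('c, 'm) game \<Rightarrow> real" where
  "min_cost G = Inf {expected_cost G \<pi> | \<pi>. admissible G \<pi>}"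

section \<open>Matroids and matroid-min-CICS\<close>

definition matroid :: "'i set \<Rightarrow> 'i set set \<Rightarrow> bool" where
  "matroid E \<I> \<longleftrightarrow> finite E \<and> \<I> \<subseteq> Pow E \<and> {} \<in> \<I> \<and>
     (\<forall>X\<in>\<I>. \<forall>Y. Y \<subseteq> X \<longrightarrow> Y \<in> \<I>) \<and>
     (\<forall>X\<in>\<I>. \<forall>Y\<in>\<I>. card X < card Y \<longrightarrow> (\<exists>e\<in>Y - X. insert e X \<in> \<I>))"

definition basis :: "'i set set \<Rightarrow> 'i set \<Rightarrow> bool" where
  "basis \<I> B \<longleftrightarrow> B \<in> \<I> \<and> (\<forall>X\<in>\<I>. B \<subseteq> X \<longrightarrow> X = B)"

definition feasible_family :: "'i set \<Rightarrow> 'i set set \<Rightarrow> 'i set set" where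
  "feasible_family E \<I> = {S. S \<subseteq> E \<and> (\<exists>B. basis \<I> B \<and> B \<subseteq> S)}"

definition matroid_min_cics :: "nat \<Rightarrow> (nat \<Rightarrow> ('s, 'a) cimdp) \<Rightarrow> nat set set \<Rightarrow> bool" where
  "matroid_min_cics n M \<I> \<longleftrightarrow> (\<forall>i\<in>{1..n}. costly_information_mdp (M i)) \<and> matroid {1..n} \<I>"

text \<open>A position holds the current state of every MDP and the set of accepted indices.\<close>

definition cics_legal ::
    "nat \<Rightarrow> (nat \<Rightarrow> ('s, 'a) cimdp) \<Rightarrow> nat set set \<Rightarrow> (nat \<Rightarrow> 's) \<times> nat set \<Rightarrow> (nat \<times> 'a act) set" where
  "cics_legal n M \<F> = (\<lambda>(x, S).
     if S \<in> \<F> then {} else {(i, \<alpha>). i \<in> {1..n} - S \<and> \<alpha> \<in> acts (M i) (x i)})"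

definition cics_price ::
    "(nat \<Rightarrow> ('s, 'a) cimdp) \<Rightarrow> (nat \<Rightarrow> 's) \<times> nat set \<Rightarrow> nat \<times> 'a act \<Rightarrow> real" where
  "cics_price M = (\<lambda>(x, S) (i, \<alpha>). act_cost (M i) (x i) \<alpha>)"

definition cics_succ ::
    "(nat \<Rightarrow> ('s, 'a) cimdp) \<Rightarrow> (nat \<Rightarrow> 's) \<times> nat set \<Rightarrow> nat \<times> 'a act \<Rightarrow>
     ((nat \<Rightarrow> 's) \<times> nat set) pmf" where
  "cics_succ M = (\<lambda>(x, S) (i, \<alpha>). case \<alpha> of
       Advance a \<Rightarrow> map_pmf (\<lambda>s'. (x(i := s'), S)) (trans (M i) (x i) a)
     | Accept \<Rightarrow> return_pmf (x, insert i S))"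

definition cics_game ::
    "nat \<Rightarrow> (nat \<Rightarrow> ('s, 'a) cimdp) \<Rightarrow> nat set set \<Rightarrow>
     ((nat \<Rightarrow> 's) \<times> nat set, nat \<times> 'a act) game" where
  "cics_game n M \<F> = \<lparr>init = (\<lambda>i. start (M i), {}), legal = cics_legal n M \<F>,
     price = cics_price M, succ = cics_succ M\<rparr>"

definition OPT :: "nat \<Rightarrow> (nat \<Rightarrow> ('s, 'a) cimdp) \<Rightarrow> nat set set \<Rightarrow> real" where
  "OPT n M \<I> = min_cost (cics_game n M (feasible_family {1..n} \<I>))"

section \<open>The local game and the water filling surrogate cost\<close>

text \<open>The position is \<open>None\<close> once the outside option or a terminal state has been accepted.\<close>

datatype 'a local_move = Outside | Play "'a act"

primrec local_legal :: "('s, 'a) cimdp \<Rightarrow> 's option \<Rightarrow> 'a local_move set" where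
  "local_legal M None = {}"
| "local_legal M (Some s) = insert Outside (Play ` acts M s)"

definition local_price :: "('s, 'a) cimdp \<Rightarrow> real \<Rightarrow> 's option \<Rightarrow> 'a local_move \<Rightarrow> real" where
  "local_price M y c m = (case m of Outside \<Rightarrow> y | Play \<alpha> \<Rightarrow> act_cost M (the c) \<alpha>)"

definition local_succ :: "('s, 'a) cimdp \<Rightarrow> 's option \<Rightarrow> 'a local_move \<Rightarrow> 's option pmf" where
  "local_succ M c m = (case m of
       Play (Advance a) \<Rightarrow> map_pmf Some (trans M (the c) a)
     | _ \<Rightarrow> return_pmf None)"

definition local_game :: "('s, 'a) cimdp \<Rightarrow> real \<Rightarrow> ('s option, 'a local_move) game" where
  "local_game M y = \<lparr>init = Some (start M), legal = local_legal M,
     price = local_price M y, succ = local_succ M\<rparr>"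

definition local_opt :: "('s, 'a) cimdp \<Rightarrow> real \<Rightarrow> real" where
  "local_opt M y = min_cost (local_game M y)"

definition surrogate_cost :: "'w measure \<Rightarrow> ('w \<Rightarrow> real) \<Rightarrow> ('s, 'a) cimdp \<Rightarrow> bool" where
  "surrogate_cost P W M \<longleftrightarrow> W \<in> borel_measurable P \<and>
     (\<forall>y. integrable P (\<lambda>\<omega>. min y (W \<omega>)) \<and>
          prob_space.expectation P (\<lambda>\<omega>. min y (W \<omega>)) = local_opt M y)"

end

theory Submission
  imports Defs
begin

text \<open>
  Write \<open>f s\<close> for the optimal value of the local game started in state \<open>s\<close>, as a function of the
  outside option. Fix \<open>\<delta> > 0\<close> and attach to every state \<open>s\<close> a law \<open>\<nu> s\<close> on the multiples of \<open>\<delta>\<close> whose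
  expected minimum with \<open>y\<close> equals \<open>f s y\<close> at all grid points \<open>y \<ge> 0\<close>; it exists because \<open>f s\<close> is
  concave, the identity on nonpositive arguments and eventually constant. The potential of a
  position is the expected cost of the cheapest completion of the accepted set, the remaining
  elements having independent weights with the laws of their current states. As a function of one
  weight \<open>u\<close> this cost has the form \<open>b + min a u\<close> or \<open>b + u\<close>, so the Bellman inequality for \<open>f\<close> shows that
  no move decreases the price paid so far plus the potential in expectation. Hence the initial
  potential bounds the cost of every policy from below. Exchanging the laws of the initial states
  for those of the surrogate costs one coordinate at a time changes the value by at most \<open>n \<delta>\<close>, and
  \<open>\<delta>\<close> is arbitrary.
\<close>

section \<open>Expectations over finitely supported distributions\<close>

lemma expectation_bind_finite:
  fixes h :: "'b \<Rightarrow> real"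
  assumes "finite (set_pmf p)" "\<And>x. x \<in> set_pmf p \<Longrightarrow> finite (set_pmf (f x))"
  shows "measure_pmf.expectation (bind_pmf p f) h =
    measure_pmf.expectation p (\<lambda>x. measure_pmf.expectation (f x) h)"
proof -
  have "measure_pmf.expectation (bind_pmf p f) h =
      (\<Sum>a\<in>set_pmf p. pmf p a *\<^sub>R measure_pmf.expectation (f a) h)"
    using assms by (intro pmf_expectation_bind) auto
  also have "\<dots> = measure_pmf.expectation p (\<lambda>x. measure_pmf.expectation (f x) h)"
    using assms by (intro integral_measure_pmf[symmetric]) auto
  finally show ?thesis .
qed

lemma expectation_mono_finite:
  fixes f g :: "'b \<Rightarrow> real"
  assumes "finite (set_pmf p)" "\<And>x. x \<in> set_pmf p \<Longrightarrow> f x \<le> g x"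
  shows "measure_pmf.expectation p f \<le> measure_pmf.expectation p g"
  using assms by (intro integral_mono_AE integrable_measure_pmf_finite) (auto simp: AE_measure_pmf_iff)

lemma expectation_cong_set_pmf:
  fixes f g :: "'b \<Rightarrow> real"
  assumes "\<And>x. x \<in> set_pmf p \<Longrightarrow> f x = g x"
  shows "measure_pmf.expectation p f = measure_pmf.expectation p g"
  using assms by (intro integral_cong_AE) (auto simp: AE_measure_pmf_iff)

section \<open>Decision problems of bounded length\<close>

text \<open>Common frame for the local game and the full game. \<open>Inv\<close> is an invariant
  containing all positions met under legal moves, and \<open>rank\<close> bounds the number of moves
  still possible; with finite branching, every expectation below is a finite sum.\<close>

locale bounded_game =
  fixes G :: "('c, 'm) game" and Inv :: "'c set" and rank :: "'c \<Rightarrow> nat"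
  assumes init_Inv: "init G \<in> Inv"
    and finite_legal: "c \<in> Inv \<Longrightarrow> finite (legal G c)"
    and finite_succ: "c \<in> Inv \<Longrightarrow> m \<in> legal G c \<Longrightarrow> finite (set_pmf (succ G c m))"
    and step: "c \<in> Inv \<Longrightarrow> m \<in> legal G c \<Longrightarrow> c' \<in> set_pmf (succ G c m) \<Longrightarrow>
      c' \<in> Inv \<and> rank c' < rank c"
begin

lemma admissible_moves:
  assumes "admissible G \<pi>" "(h, c) \<in> set_pmf (play G \<pi> k)" "legal G c \<noteq> {}"
  shows "set_pmf (\<pi> (h, c)) \<subseteq> legal G c"
  using assms unfolding admissible_def by blast

text \<open>Each legal move lowers \<open>rank\<close> by at least one, so after \<open>k\<close>
  rounds an unfinished play has used up \<open>k\<close> units of the initial rank.\<close>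

lemma play_rank:
  assumes "admissible G \<pi>" "(h, c) \<in> set_pmf (play G \<pi> k)"
  shows "c \<in> Inv \<and> (legal G c = {} \<or> rank c + k \<le> rank (init G))"
  using assms(2)
proof (induction k arbitrary: h c)
  case 0
  then show ?case using init_Inv by auto
next
  case (Suc k)
  then obtain h0 c0 where prev: "(h0, c0) \<in> set_pmf (play G \<pi> k)"
    and next_: "(h, c) \<in> set_pmf (play_step G \<pi> (h0, c0))" by auto
  note IH = Suc.IH[OF prev]
  show ?case
  proof (cases "legal G c0 = {}")
    case True
    with next_ IH show ?thesis by (auto simp: play_step_def)
  next
    case False
    with next_ obtain m where m: "m \<in> set_pmf (\<pi> (h0, c0))" "c \<in> set_pmf (succ G c0 m)"
      by (auto simp: play_step_def)
    with admissible_moves[OF assms(1) prev False] have "m \<in> legal G c0" by auto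
    from step[OF _ this m(2)] IH False show ?thesis by auto
  qed
qed

lemma finite_play_step:
  assumes "admissible G \<pi>" "hc \<in> set_pmf (play G \<pi> k)"
  shows "finite (set_pmf (play_step G \<pi> hc))"
proof -
  obtain h c where hc: "hc = (h, c)" by (cases hc)
  have Inv: "c \<in> Inv" using play_rank assms hc by blast
  show ?thesis
  proof (cases "legal G c = {}")
    case False
    then have sub: "set_pmf (\<pi> (h, c)) \<subseteq> legal G c" using admissible_moves assms hc by blast
    then have "finite (set_pmf (\<pi> (h, c)))" using finite_legal[OF Inv] finite_subset by blast
    with sub finite_succ[OF Inv] show ?thesis
      by (auto simp: play_step_def hc False intro!: finite_UN_I finite_imageI)
  qed (simp add: play_step_def hc)
qed

lemma finite_play:
  assumes "admissible G \<pi>"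
  shows "finite (set_pmf (play G \<pi> k))"
  by (induction k) (use finite_play_step[OF assms] in auto)

text \<open>After \<open>Suc (rank (init G))\<close> rounds the rank budget is exceeded, so every
  play has ended and \<open>play_step\<close> acts as the identity. The sequence of distributions is
  constant from there on and the limit is its value.\<close>

lemma expected_cost_eq:
  assumes "admissible G \<pi>"
  shows "expected_cost G \<pi> =
    measure_pmf.expectation (play G \<pi> (Suc (rank (init G)))) (total_price G)"
proof -
  let ?N = "Suc (rank (init G))"
  have stable: "play G \<pi> (Suc k) = play G \<pi> k" if "k \<ge> ?N" for k
  proof -
    have "bind_pmf (play G \<pi> k) (play_step G \<pi>) = bind_pmf (play G \<pi> k) return_pmf"
    proof (rule bind_pmf_cong[OF refl])
      fix hc assume "hc \<in> set_pmf (play G \<pi> k)"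
      with play_rank[OF assms, of "fst hc" "snd hc" k] that
      have "legal G (snd hc) = {}" by auto
      then show "play_step G \<pi> hc = return_pmf hc"
        by (cases hc) (simp add: play_step_def)
    qed
    then show ?thesis by (simp add: bind_return_pmf')
  qed
  have "play G \<pi> k = play G \<pi> ?N" if "k \<ge> ?N" for k
    using that by (induction k rule: dec_induct) (auto simp only: stable)
  then have "(\<lambda>k. measure_pmf.expectation (play G \<pi> k) (total_price G)) \<longlonglongrightarrow>
      measure_pmf.expectation (play G \<pi> ?N) (total_price G)"
    by (intro tendsto_eventually eventually_sequentiallyI[of ?N]
        arg_cong[where f = "\<lambda>p. measure_pmf.expectation p (total_price G)"])
  then show ?thesis unfolding expected_cost_def by (rule limI)
qed

text \<open>Conditioning on the history before the last round. A finished play contributes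
  unchanged; otherwise the price of the new move is added and \<Psi> is averaged over the
  successor.\<close>

lemma expectation_play_Suc:
  fixes \<Psi> :: "'c \<Rightarrow> real"
  assumes adm: "admissible G \<pi>"
  shows "measure_pmf.expectation (play G \<pi> (Suc k)) (\<lambda>(h, c). total_price G (h, c) + \<Psi> c) =
    measure_pmf.expectation (play G \<pi> k) (\<lambda>(h, c). total_price G (h, c) +
      (if legal G c = {} then \<Psi> c
       else measure_pmf.expectation (\<pi> (h, c)) (\<lambda>m. price G c m + measure_pmf.expectation (succ G c m) \<Psi>)))"
proof -
  have "measure_pmf.expectation (play_step G \<pi> hc) (\<lambda>(h, c). total_price G (h, c) + \<Psi> c) =
     (\<lambda>(h, c). total_price G (h, c) +
      (if legal G c = {} then \<Psi> c
       else measure_pmf.expectation (\<pi> (h, c)) (\<lambda>m. price G c m + measure_pmf.expectation (succ G c m) \<Psi>))) hc"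
    if hc: "hc \<in> set_pmf (play G \<pi> k)" for hc
  proof -
    obtain h c where [simp]: "hc = (h, c)" by (cases hc)
    have Inv: "c \<in> Inv" using play_rank[OF adm] hc by auto
    show ?thesis
    proof (cases "legal G c = {}")
      case True
      then show ?thesis by (simp add: play_step_def)
    next
      case False
      have sub: "set_pmf (\<pi> (h, c)) \<subseteq> legal G c" using admissible_moves[OF adm] hc False by auto
      have fin: "finite (set_pmf (\<pi> (h, c)))" using sub finite_legal[OF Inv] finite_subset by blast
      have "measure_pmf.expectation (play_step G \<pi> hc) (\<lambda>(h, c). total_price G (h, c) + \<Psi> c) =
        measure_pmf.expectation (\<pi> (h, c)) (\<lambda>m. measure_pmf.expectation
          (map_pmf (\<lambda>c'. ((c, m) # h, c')) (succ G c m)) (\<lambda>(h, c). total_price G (h, c) + \<Psi> c))"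
        using False fin sub finite_succ[OF Inv]
        by (subst expectation_bind_finite[symmetric]) (auto simp: play_step_def)
      also have "\<dots> = measure_pmf.expectation (\<pi> (h, c)) (\<lambda>m. total_price G (h, c) +
          (price G c m + measure_pmf.expectation (succ G c m) \<Psi>))"
      proof (rule expectation_cong_set_pmf)
        fix m assume "m \<in> set_pmf (\<pi> (h, c))"
        with sub finite_succ[OF Inv] have "finite (set_pmf (succ G c m))" by auto
        then show "measure_pmf.expectation
            (map_pmf (\<lambda>c'. ((c, m) # h, c')) (succ G c m)) (\<lambda>(h, c). total_price G (h, c) + \<Psi> c) =
          total_price G (h, c) + (price G c m + measure_pmf.expectation (succ G c m) \<Psi>)"
          by (simp add: total_price_def integrable_measure_pmf_finite)
      qed
      also have "\<dots> = total_price G (h, c) + measure_pmf.expectation (\<pi> (h, c))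
          (\<lambda>m. price G c m + measure_pmf.expectation (succ G c m) \<Psi>)"
        using fin by (subst Bochner_Integration.integral_add) (auto intro: integrable_measure_pmf_finite)
      finally show ?thesis using False by simp
    qed
  qed
  then show ?thesis
    using finite_play[OF adm, of k] finite_play_step[OF adm]
    by (auto simp: expectation_bind_finite intro!: expectation_cong_set_pmf)
qed

text \<open>Price paid so far plus \<Psi> is a submartingale under every admissible policy. It
  starts at \<open>\<Psi> (init G)\<close>, and at the end \<Psi> is at most 0, so the expected
  price alone is no smaller.\<close>

lemma expected_cost_ge_potential:
  fixes \<Psi> :: "'c \<Rightarrow> real"
  assumes adm: "admissible G \<pi>"
    and ended: "\<And>c. c \<in> Inv \<Longrightarrow> legal G c = {} \<Longrightarrow> \<Psi> c \<le> 0"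
    and local_le: "\<And>c m. c \<in> Inv \<Longrightarrow> m \<in> legal G c \<Longrightarrow>
      \<Psi> c \<le> price G c m + measure_pmf.expectation (succ G c m) \<Psi>"
  shows "\<Psi> (init G) \<le> expected_cost G \<pi>"
proof -
  let ?g = "\<lambda>(h, c). total_price G (h, c) + \<Psi> c"
  have lower: "\<Psi> (init G) \<le> measure_pmf.expectation (play G \<pi> k) ?g" for k
  proof (induction k)
    case 0
    then show ?case by (simp add: total_price_def)
  next
    case (Suc k)
    also have "measure_pmf.expectation (play G \<pi> k) ?g \<le>
        measure_pmf.expectation (play G \<pi> (Suc k)) ?g"
      unfolding expectation_play_Suc[OF adm]
    proof (rule expectation_mono_finite[OF finite_play[OF adm]], clarify)
      fix h c assume hc: "(h, c) \<in> set_pmf (play G \<pi> k)"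
      have Inv: "c \<in> Inv" using play_rank[OF adm hc] by simp
      have "\<Psi> c \<le> measure_pmf.expectation (\<pi> (h, c))
          (\<lambda>m. price G c m + measure_pmf.expectation (succ G c m) \<Psi>)" if "legal G c \<noteq> {}"
      proof -
        have sub: "set_pmf (\<pi> (h, c)) \<subseteq> legal G c" by (rule admissible_moves[OF adm hc that])
        then have "finite (set_pmf (\<pi> (h, c)))" using finite_legal[OF Inv] finite_subset by blast
        then have "measure_pmf.expectation (\<pi> (h, c)) (\<lambda>_. \<Psi> c) \<le> measure_pmf.expectation (\<pi> (h, c))
          (\<lambda>m. price G c m + measure_pmf.expectation (succ G c m) \<Psi>)"
          using sub local_le[OF Inv] by (intro expectation_mono_finite) auto
        then show ?thesis by simp
      qed
      then show "total_price G (h, c) + \<Psi> c \<le> total_price G (h, c) +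
         (if legal G c = {} then \<Psi> c else measure_pmf.expectation (\<pi> (h, c))
          (\<lambda>m. price G c m + measure_pmf.expectation (succ G c m) \<Psi>))" by simp
    qed
    finally show ?case .
  qed
  have "measure_pmf.expectation (play G \<pi> (Suc (rank (init G)))) ?g \<le>
      measure_pmf.expectation (play G \<pi> (Suc (rank (init G)))) (total_price G)"
  proof (rule expectation_mono_finite[OF finite_play[OF adm]], clarify)
    fix h c assume "(h, c) \<in> set_pmf (play G \<pi> (Suc (rank (init G))))"
    from play_rank[OF adm this] ended[of c]
    show "total_price G (h, c) + \<Psi> c \<le> total_price G (h, c)" by auto
  qed
  with lower[of "Suc (rank (init G))"] show ?thesis
    by (simp only: expected_cost_eq[OF adm])
qed

text \<open>The supermartingale counterpart, for a memoryless deterministic policy whose chosen move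
  does not raise price plus \<Psi> in expectation.\<close>

lemma expected_cost_le_potential:
  fixes \<Psi> :: "'c \<Rightarrow> real"
  assumes adm: "admissible G (\<lambda>(h, c). return_pmf (\<phi> c))"
    and ended: "\<And>c. c \<in> Inv \<Longrightarrow> legal G c = {} \<Longrightarrow> 0 \<le> \<Psi> c"
    and local_ge: "\<And>c. c \<in> Inv \<Longrightarrow> legal G c \<noteq> {} \<Longrightarrow>
      price G c (\<phi> c) + measure_pmf.expectation (succ G c (\<phi> c)) \<Psi> \<le> \<Psi> c"
  shows "expected_cost G (\<lambda>(h, c). return_pmf (\<phi> c)) \<le> \<Psi> (init G)"
proof -
  let ?\<pi> = "\<lambda>(h, c). return_pmf (\<phi> c)"
  let ?g = "\<lambda>(h, c). total_price G (h, c) + \<Psi> c"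
  have upper: "measure_pmf.expectation (play G ?\<pi> k) ?g \<le> \<Psi> (init G)" for k
  proof (induction k)
    case 0
    then show ?case by (simp add: total_price_def)
  next
    case (Suc k)
    have "measure_pmf.expectation (play G ?\<pi> (Suc k)) ?g \<le>
        measure_pmf.expectation (play G ?\<pi> k) ?g"
      unfolding expectation_play_Suc[OF adm]
    proof (rule expectation_mono_finite[OF finite_play[OF adm]], clarify)
      fix h c assume hc: "(h, c) \<in> set_pmf (play G ?\<pi> k)"
      have Inv: "c \<in> Inv" using play_rank[OF adm hc] by simp
      show "total_price G (h, c) +
         (if legal G c = {} then \<Psi> c else measure_pmf.expectation (return_pmf (\<phi> c))
          (\<lambda>m. price G c m + measure_pmf.expectation (succ G c m) \<Psi>)) \<le> total_price G (h, c) + \<Psi> c"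
        using local_ge[OF Inv] by simp
    qed
    with Suc show ?case by simp
  qed
  have "measure_pmf.expectation (play G ?\<pi> (Suc (rank (init G)))) (total_price G) \<le>
      measure_pmf.expectation (play G ?\<pi> (Suc (rank (init G)))) ?g"
  proof (rule expectation_mono_finite[OF finite_play[OF adm]], clarify)
    fix h c assume "(h, c) \<in> set_pmf (play G ?\<pi> (Suc (rank (init G))))"
    from play_rank[OF adm this] ended[of c]
    show "total_price G (h, c) \<le> total_price G (h, c) + \<Psi> c" by auto
  qed
  with upper[of "Suc (rank (init G))"] show ?thesis
    by (simp only: expected_cost_eq[OF adm])
qed

text \<open>Admissibility refers to the histories produced by the policy itself, so the invariant is
  propagated along its own play first; legality on \<open>Inv\<close> then suffices.\<close>

lemma admissible_markov:
  assumes "\<And>c. c \<in> Inv \<Longrightarrow> legal G c \<noteq> {} \<Longrightarrow> \<phi> c \<in> legal G c"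
  shows "admissible G (\<lambda>(h, c). return_pmf (\<phi> c))"
proof -
  have "c \<in> Inv" if "(h, c) \<in> set_pmf (play G (\<lambda>(h, c). return_pmf (\<phi> c)) k)" for h c k
    using that
  proof (induction k arbitrary: h c)
    case 0
    then show ?case using init_Inv by simp
  next
    case (Suc k)
    then obtain h0 c0 where "(h0, c0) \<in> set_pmf (play G (\<lambda>(h, c). return_pmf (\<phi> c)) k)"
      and next_: "(h, c) \<in> set_pmf (play_step G (\<lambda>(h, c). return_pmf (\<phi> c)) (h0, c0))" by auto
    with Suc.IH have "c0 \<in> Inv" by blast
    with next_ assms step show ?case
      by (cases "legal G c0 = {}") (auto simp: play_step_def bind_return_pmf)
  qed
  with assms show ?thesis unfolding admissible_def by (simp split: prod.split) blast
qed

lemma min_cost_ge_potential: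
  fixes \<Psi> :: "'c \<Rightarrow> real"
  assumes ended: "\<And>c. c \<in> Inv \<Longrightarrow> legal G c = {} \<Longrightarrow> \<Psi> c \<le> 0"
    and local_le: "\<And>c m. c \<in> Inv \<Longrightarrow> m \<in> legal G c \<Longrightarrow>
      \<Psi> c \<le> price G c m + measure_pmf.expectation (succ G c m) \<Psi>"
  shows "\<Psi> (init G) \<le> min_cost G"
  unfolding min_cost_def
proof (rule cInf_greatest)
  \<comment> \<open>The infimum is bounded below by a common lower bound only over a nonempty set;
    picking an arbitrary legal move shows that some admissible policy exists.\<close>
  have "admissible G (\<lambda>(h, c). return_pmf (SOME m. m \<in> legal G c))"
    by (rule admissible_markov) (auto intro: someI)
  then show "{expected_cost G \<pi> |\<pi>. admissible G \<pi>} \<noteq> {}" by blast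
qed (use expected_cost_ge_potential[where \<Psi> = \<Psi>] assms in blast)

text \<open>Two potentials are needed: \<Psi> bounds the cost of the policy choosing the move
  provided by \<open>local_ge\<close>, while \<Phi> bounds all policies from below, so that the
  infimum really lies below the cost of that policy.\<close>

lemma min_cost_le_potential:
  fixes \<Psi> \<Phi> :: "'c \<Rightarrow> real"
  assumes ended0: "\<And>c. c \<in> Inv \<Longrightarrow> legal G c = {} \<Longrightarrow> \<Phi> c \<le> 0"
    and local_le0: "\<And>c m. c \<in> Inv \<Longrightarrow> m \<in> legal G c \<Longrightarrow>
      \<Phi> c \<le> price G c m + measure_pmf.expectation (succ G c m) \<Phi>"
    and ended: "\<And>c. c \<in> Inv \<Longrightarrow> legal G c = {} \<Longrightarrow> 0 \<le> \<Psi> c"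
    and local_ge: "\<And>c. c \<in> Inv \<Longrightarrow> legal G c \<noteq> {} \<Longrightarrow> \<exists>m\<in>legal G c.
      price G c m + measure_pmf.expectation (succ G c m) \<Psi> \<le> \<Psi> c"
  shows "min_cost G \<le> \<Psi> (init G)"
proof -
  obtain \<phi> where \<phi>: "\<And>c. c \<in> Inv \<Longrightarrow> legal G c \<noteq> {} \<Longrightarrow> \<phi> c \<in> legal G c \<and>
      price G c (\<phi> c) + measure_pmf.expectation (succ G c (\<phi> c)) \<Psi> \<le> \<Psi> c"
    using local_ge by metis
  have adm: "admissible G (\<lambda>(h, c). return_pmf (\<phi> c))"
    using \<phi> by (intro admissible_markov) auto
  have "bdd_below {expected_cost G \<pi> |\<pi>. admissible G \<pi>}"
    using expected_cost_ge_potential[where \<Psi> = \<Phi>] ended0 local_le0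
    by (intro bdd_belowI[of _ "\<Phi> (init G)"]) blast
  then have "min_cost G \<le> expected_cost G (\<lambda>(h, c). return_pmf (\<phi> c))"
    unfolding min_cost_def using adm by (intro cInf_lower) auto
  also have "\<dots> \<le> \<Psi> (init G)"
    using \<phi> ended by (intro expected_cost_le_potential[OF adm]) auto
  finally show ?thesis .
qed

end

section \<open>The Bellman value of the local game\<close>

text \<open>Recursion along the converse of the transition relation, so that successors count as
  smaller. The outside option is available at every state.\<close>

definition bellman :: "('s, 'a) cimdp \<Rightarrow> 's \<Rightarrow> real \<Rightarrow> real" where
  "bellman M = wfrec ((edges M)\<inverse>) (\<lambda>f s y.
     if s \<in> terminals M then min y (mean_val M s)
     else min y (Min ((\<lambda>a. cost M a + measure_pmf.expectation (trans M s a) (\<lambda>s'. f s' y)) ` actions M s)))"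

locale costly_mdp =
  fixes M :: "('s, 'a) cimdp"
  assumes cim: "costly_information_mdp M"
begin

section \<open>Finiteness and well-foundedness of the transition graph\<close>

lemma finite_states: "finite (states M)"
  and start_state: "start M \<in> states M"
  and terminals_sub: "terminals M \<subseteq> states M"
  and acyclic_edges: "acyclic (edges M)"
  using cim unfolding costly_information_mdp_def by blast+

lemma finite_actions: "s \<in> states M \<Longrightarrow> s \<notin> terminals M \<Longrightarrow> finite (actions M s)"
  and actions_nonempty: "s \<in> states M \<Longrightarrow> s \<notin> terminals M \<Longrightarrow> actions M s \<noteq> {}"
  and cost_nonneg: "s \<in> states M \<Longrightarrow> s \<notin> terminals M \<Longrightarrow> a \<in> actions M s \<Longrightarrow> 0 \<le> cost M a"
  and trans_states: "s \<in> states M \<Longrightarrow> s \<notin> terminals M \<Longrightarrow> a \<in> actions M s \<Longrightarrow>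
    set_pmf (trans M s a) \<subseteq> states M"
  using cim unfolding costly_information_mdp_def by blast+

lemma finite_trans:
  "s \<in> states M \<Longrightarrow> s \<notin> terminals M \<Longrightarrow> a \<in> actions M s \<Longrightarrow> finite (set_pmf (trans M s a))"
  using trans_states finite_states finite_subset by metis

lemma mean_val_nonneg: "s \<in> states M \<Longrightarrow> 0 \<le> mean_val M s"
  using cim unfolding costly_information_mdp_def mean_val_def by (auto intro: integral_nonneg_AE)

lemma edges_sub: "edges M \<subseteq> states M \<times> states M"
  using trans_states by (auto simp: edges_def)

lemma finite_edges: "finite (edges M)"
  using edges_sub finite_states finite_subset by blast

lemma wf_edges: "wf ((edges M)\<inverse>)"
  using finite_edges acyclic_edges by (rule finite_acyclic_wf_converse)

lemma edgeI:
  "s \<in> states M \<Longrightarrow> s \<notin> terminals M \<Longrightarrow> a \<in> actions M s \<Longrightarrow> s' \<in> set_pmf (trans M s a) \<Longrightarrow>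
    (s, s') \<in> edges M"
  by (auto simp: edges_def)

text \<open>The number of states reachable in at least one step. It serves as the rank of a state in
  both games.\<close>

definition height :: "'s \<Rightarrow> nat" where
  "height s = card {s'. (s, s') \<in> (edges M)\<^sup>+}"

text \<open>What is reachable from \<open>s'\<close> is reachable from \<open>s\<close>; by
  acyclicity \<open>s'\<close> itself is reachable only from \<open>s\<close>, which makes the
  inclusion strict.\<close>

lemma height_less:
  assumes "(s, s') \<in> edges M"
  shows "height s' < height s"
  unfolding height_def
proof (rule psubset_card_mono)
  have "{s'. (s, s') \<in> (edges M)\<^sup>+} \<subseteq> snd ` ((edges M)\<^sup>+)" by force
  then show "finite {s'. (s, s') \<in> (edges M)\<^sup>+}"
    using finite_trancl finite_edges finite_subset by blast
  have "s' \<notin> {t. (s', t) \<in> (edges M)\<^sup>+}" "s' \<in> {t. (s, t) \<in> (edges M)\<^sup>+}"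
    using acyclic_edges assms by (auto simp: acyclic_def)
  moreover have "{t. (s', t) \<in> (edges M)\<^sup>+} \<subseteq> {t. (s, t) \<in> (edges M)\<^sup>+}"
    using assms by (auto intro: trancl_into_trancl2)
  ultimately show "{t. (s', t) \<in> (edges M)\<^sup>+} \<subset> {t. (s, t) \<in> (edges M)\<^sup>+}" by blast
qed

lemma state_induct [consumes 1, case_names terminal interior]:
  assumes "s \<in> states M"
    and "\<And>s. s \<in> terminals M \<Longrightarrow> P s"
    and "\<And>s. s \<in> states M \<Longrightarrow> s \<notin> terminals M \<Longrightarrow>
      (\<And>a s'. a \<in> actions M s \<Longrightarrow> s' \<in> set_pmf (trans M s a) \<Longrightarrow> P s') \<Longrightarrow> P s"
  shows "P s"
  using wf_edges assms(1)
proof (induction s rule: wf_induct_rule)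
  case (less s)
  show ?case
  proof (cases "s \<in> terminals M")
    case False
    show ?thesis
    proof (rule assms(3)[OF less(2) False])
      fix a s' assume "a \<in> actions M s" "s' \<in> set_pmf (trans M s a)"
      with less(2) False show "P s'"
        using trans_states edgeI by (intro less(1)) blast+
    qed
  qed (rule assms(2))
qed

text \<open>The guard \<open>cut\<close> restricts recursive calls to graph successors. It
  disappears in the next equations because every state of positive transition probability is such a
  successor.\<close>

lemma bellman_unfold:
  "bellman M s y =
     (if s \<in> terminals M then min y (mean_val M s)
      else min y (Min ((\<lambda>a. cost M a + measure_pmf.expectation (trans M s a)
        (\<lambda>s'. cut (bellman M) ((edges M)\<inverse>) s s' y)) ` actions M s)))"
  by (subst bellman_def, subst wfrec[OF wf_edges], fold bellman_def) (rule refl)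

lemma bellman_terminal: "s \<in> terminals M \<Longrightarrow> bellman M s y = min y (mean_val M s)"
  by (simp add: bellman_unfold)

lemma bellman_nonterminal:
  assumes "s \<in> states M" "s \<notin> terminals M"
  shows "bellman M s y = min y (Min ((\<lambda>a. cost M a +
    measure_pmf.expectation (trans M s a) (\<lambda>s'. bellman M s' y)) ` actions M s))"
proof -
  have "measure_pmf.expectation (trans M s a) (\<lambda>s'. cut (bellman M) ((edges M)\<inverse>) s s' y) =
      measure_pmf.expectation (trans M s a) (\<lambda>s'. bellman M s' y)" if "a \<in> actions M s" for a
    using assms that by (intro expectation_cong_set_pmf) (simp add: cut_apply edgeI)
  then show ?thesis
    using assms by (subst bellman_unfold) (simp cong: image_cong)
qed

section \<open>Bellman inequalities and the shape of the Bellman value in the outside option\<close>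

lemma bellman_le_outside: "bellman M s y \<le> y"
  by (simp add: bellman_unfold)

lemma bellman_le_advance:
  assumes "s \<in> states M" "s \<notin> terminals M" "a \<in> actions M s"
  shows "bellman M s y \<le> cost M a + measure_pmf.expectation (trans M s a) (\<lambda>s'. bellman M s' y)"
  using assms finite_actions by (auto simp: bellman_nonterminal intro!: min.coboundedI2 Min_le)

lemma bellman_attained:
  assumes "s \<in> states M" "s \<notin> terminals M"
  shows "bellman M s y = y \<or> (\<exists>a\<in>actions M s.
    bellman M s y = cost M a + measure_pmf.expectation (trans M s a) (\<lambda>s'. bellman M s' y))"
proof -
  let ?A = "(\<lambda>a. cost M a + measure_pmf.expectation (trans M s a) (\<lambda>s'. bellman M s' y)) ` actions M s"
  have "Min ?A \<in> ?A" using assms finite_actions actions_nonempty by (intro Min_in) auto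
  then show ?thesis by (auto simp: bellman_nonterminal[OF assms] min_def)
qed

text \<open>Action costs and values are nonnegative, so nothing beats taking a nonpositive outside
  option at once.\<close>

lemma bellman_eq_nonpos:
  assumes "s \<in> states M" "y \<le> 0"
  shows "bellman M s y = y"
  using assms(1)
proof (induction s rule: state_induct)
  case (terminal s)
  then show ?case
    using mean_val_nonneg terminals_sub assms(2) by (fastforce simp: bellman_terminal)
next
  case (interior s)
  have "y \<le> cost M a + measure_pmf.expectation (trans M s a) (\<lambda>s'. bellman M s' y)"
    if a: "a \<in> actions M s" for a
  proof -
    have "measure_pmf.expectation (trans M s a) (\<lambda>s'. bellman M s' y) =
        measure_pmf.expectation (trans M s a) (\<lambda>s'. y)"
      using interior a by (intro expectation_cong_set_pmf)
    then show ?thesis using cost_nonneg[OF interior(1,2) a] by simp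
  qed
  then show ?case using bellman_attained[OF interior(1,2), of y] bellman_le_outside[of s y] by fastforce
qed

text \<open>The choice that is optimal for \<open>z\<close> is also available for \<open>y\<close>,
  and by induction costs no more there.\<close>

lemma bellman_mono:
  assumes "s \<in> states M" "y \<le> z"
  shows "bellman M s y \<le> bellman M s z"
  using assms(1)
proof (induction s rule: state_induct)
  case (terminal s)
  then show ?case using assms(2) by (auto simp: bellman_terminal)
next
  case (interior s)
  from bellman_attained[OF interior(1,2), of z] show ?case
  proof (elim disjE bexE)
    assume "bellman M s z = z"
    with bellman_le_outside[of s y] assms(2) show ?thesis by simp
  next
    fix a assume a: "a \<in> actions M s"
      and eq: "bellman M s z = cost M a + measure_pmf.expectation (trans M s a) (\<lambda>s'. bellman M s' z)"
    have "measure_pmf.expectation (trans M s a) (\<lambda>s'. bellman M s' y) \<le>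
        measure_pmf.expectation (trans M s a) (\<lambda>s'. bellman M s' z)"
      using a interior finite_trans by (intro expectation_mono_finite) auto
    with bellman_le_advance[OF interior(1,2) a, of y] eq show ?thesis by linarith
  qed
qed

text \<open>The choice that is optimal at the midpoint \<open>y\<close> is used at both
  \<open>y - d\<close> and \<open>y + d\<close>. It need not be optimal there, so the two values sum
  to at most twice the middle one.\<close>

lemma bellman_midpoint_concave:
  assumes "s \<in> states M"
  shows "bellman M s (y - d) + bellman M s (y + d) \<le> 2 * bellman M s y"
  using assms
proof (induction s rule: state_induct)
  case (terminal s)
  then show ?case by (auto simp: bellman_terminal)
next
  case (interior s)
  from bellman_attained[OF interior(1,2), of y] show ?case
  proof (elim disjE bexE)
    assume "bellman M s y = y"
    with bellman_le_outside[of s "y - d"] bellman_le_outside[of s "y + d"] show ?thesis by simp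
  next
    fix a assume a: "a \<in> actions M s"
      and eq: "bellman M s y = cost M a + measure_pmf.expectation (trans M s a) (\<lambda>s'. bellman M s' y)"
    have fin: "finite (set_pmf (trans M s a))" using finite_trans interior a by blast
    have "measure_pmf.expectation (trans M s a) (\<lambda>s'. bellman M s' (y - d) + bellman M s' (y + d)) \<le>
        measure_pmf.expectation (trans M s a) (\<lambda>s'. 2 * bellman M s' y)"
      using fin a interior by (intro expectation_mono_finite) auto
    moreover have "measure_pmf.expectation (trans M s a) (\<lambda>s'. bellman M s' (y - d) + bellman M s' (y + d)) =
        measure_pmf.expectation (trans M s a) (\<lambda>s'. bellman M s' (y - d)) +
        measure_pmf.expectation (trans M s a) (\<lambda>s'. bellman M s' (y + d))"
      using fin by (intro Bochner_Integration.integral_add integrable_measure_pmf_finite)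
    ultimately show ?thesis
      using bellman_le_advance[OF interior(1,2) a, of "y - d"]
        bellman_le_advance[OF interior(1,2) a, of "y + d"] eq by simp
  qed
qed

text \<open>A large outside option is never worth taking. There are finitely many actions and
  successors, so one threshold makes all the expectations constant simultaneously.\<close>

lemma bellman_eventually_const:
  assumes "s \<in> states M"
  shows "\<exists>C. eventually (\<lambda>y. bellman M s y = C) at_top"
  using assms
proof (induction s rule: state_induct)
  case (terminal s)
  then show ?case
    by (intro exI[of _ "mean_val M s"] eventually_at_top_linorderI[of "mean_val M s"])
      (simp add: bellman_terminal min_def)
next
  case (interior s)
  have "\<exists>D. eventually (\<lambda>y. measure_pmf.expectation (trans M s a) (\<lambda>s'. bellman M s' y) = D) at_top"
    if a: "a \<in> actions M s" for a
  proof -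
    obtain C where "\<And>s'. s' \<in> set_pmf (trans M s a) \<Longrightarrow> eventually (\<lambda>y. bellman M s' y = C s') at_top"
      using interior.IH[OF a] by metis
    then have "eventually (\<lambda>y. \<forall>s'\<in>set_pmf (trans M s a). bellman M s' y = C s') at_top"
      using finite_trans[OF interior(1,2) a] by (simp add: eventually_ball_finite_distrib)
    then have "eventually (\<lambda>y. measure_pmf.expectation (trans M s a) (\<lambda>s'. bellman M s' y) =
        measure_pmf.expectation (trans M s a) C) at_top"
      by eventually_elim (intro expectation_cong_set_pmf, simp)
    then show ?thesis by blast
  qed
  then obtain D where "\<And>a. a \<in> actions M s \<Longrightarrow>
      eventually (\<lambda>y. measure_pmf.expectation (trans M s a) (\<lambda>s'. bellman M s' y) = D a) at_top"
    by metis
  then have "eventually (\<lambda>y. \<forall>a\<in>actions M s.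
      measure_pmf.expectation (trans M s a) (\<lambda>s'. bellman M s' y) = D a) at_top"
    using finite_actions[OF interior(1,2)] by (simp add: eventually_ball_finite_distrib)
  \<comment> \<open>The best constant value over the actions; once \<open>y\<close> exceeds it, the
    outside option drops out of the minimum.\<close>
  moreover define m where "m = Min ((\<lambda>a. cost M a + D a) ` actions M s)"
  have "eventually (\<lambda>y. m \<le> y) at_top" by (rule eventually_ge_at_top)
  ultimately have "eventually (\<lambda>y. bellman M s y = m) at_top"
    by eventually_elim (simp add: bellman_nonterminal[OF interior(1,2)] m_def min_def cong: image_cong)
  then show ?case by blast
qed

lemma bellman_stabilises:
  assumes "s \<in> states M"
  shows "\<exists>K C. \<forall>y. bellman M s y \<le> C \<and> (K \<le> y \<longrightarrow> bellman M s y = C)"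
proof -
  obtain C K where K: "\<And>y. K \<le> y \<Longrightarrow> bellman M s y = C"
    using bellman_eventually_const[OF assms] by (auto simp: eventually_at_top_linorder)
  moreover have "bellman M s y \<le> C" for y
    using bellman_mono[OF assms, of y "max y K"] K[of "max y K"] by simp
  ultimately show ?thesis by blast
qed

section \<open>Comparison of the Bellman value with the optimum of the local game\<close>

lemma acts_nonempty: "s \<in> states M \<Longrightarrow> acts M s \<noteq> {}"
  using actions_nonempty by (auto simp: acts_def)

lemma finite_acts: "s \<in> states M \<Longrightarrow> finite (acts M s)"
  using finite_actions by (auto simp: acts_def)

lemma local_opt_le_bellman: "local_opt M y \<le> bellman M (start M) y"
proof -
  \<comment> \<open>The additional unit accounts for the closing move that accepts
    something.\<close>
  define rank where "rank c = (case c of None \<Rightarrow> 0 | Some s \<Rightarrow> Suc (height s))" for c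
  let ?G = "local_game M y"
  interpret bounded_game ?G "{c. \<forall>s. c = Some s \<longrightarrow> s \<in> states M}" rank
  proof
    show "init ?G \<in> {c. \<forall>s. c = Some s \<longrightarrow> s \<in> states M}"
      by (simp add: local_game_def start_state)
  next
    fix c assume c: "c \<in> {c. \<forall>s. c = Some s \<longrightarrow> s \<in> states M}"
    then show "finite (legal ?G c)"
      by (cases c) (auto simp: local_game_def finite_acts)
    fix m assume m: "m \<in> legal ?G c"
    with c obtain s where s: "c = Some s" "s \<in> states M" by (cases c) (auto simp: local_game_def)
    from m s show "finite (set_pmf (succ ?G c m))"
      by (auto simp: local_game_def local_succ_def acts_def finite_trans split: if_splits)
    fix c' assume "c' \<in> set_pmf (succ ?G c m)"
    with m s show "c' \<in> {c. \<forall>s. c = Some s \<longrightarrow> s \<in> states M} \<and> rank c' < rank c"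
      using height_less[OF edgeI]
      by (auto simp: local_game_def local_succ_def acts_def rank_def split: if_splits
          dest: subsetD[OF trans_states])
  qed
  \<comment> \<open>With nonnegative costs and values no play costs less than
    \<open>min y 0\<close>; this crude potential keeps the infimum bounded below.\<close>
  define \<Phi> where "\<Phi> c = (case c of None \<Rightarrow> 0 | Some (s :: 's) \<Rightarrow> min y 0)" for c
  define \<Psi> where "\<Psi> c = (case c of None \<Rightarrow> 0 | Some s \<Rightarrow> bellman M s y)" for c
  have "min_cost ?G \<le> \<Psi> (init ?G)"
  proof (rule min_cost_le_potential[where \<Phi> = \<Phi>])
    fix c assume c: "c \<in> {c. \<forall>s. c = Some s \<longrightarrow> s \<in> states M}"
    show "\<Phi> c \<le> 0" by (simp add: \<Phi>_def split: option.split)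
    show "legal ?G c = {} \<Longrightarrow> 0 \<le> \<Psi> c"
      by (cases c) (auto simp: local_game_def \<Psi>_def)
    {
      fix m assume m: "m \<in> legal ?G c"
      with c obtain s where s: "c = Some s" "s \<in> states M" by (cases c) (auto simp: local_game_def)
      with m show "\<Phi> c \<le> price ?G c m + measure_pmf.expectation (succ ?G c m) \<Phi>"
        using cost_nonneg mean_val_nonneg
        by (auto simp: local_game_def local_succ_def local_price_def acts_def \<Phi>_def min_def
            intro: order_trans split: if_splits)
    }
    assume "legal ?G c \<noteq> {}"
    with c obtain s where s: "c = Some s" "s \<in> states M" by (cases c) (auto simp: local_game_def)
    show "\<exists>m\<in>legal ?G c. price ?G c m + measure_pmf.expectation (succ ?G c m) \<Psi> \<le> \<Psi> c"
    \<comment> \<open>The move is the one attaining the Bellman minimum: the outside option, else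
      acceptance at a terminal state, else an optimal action.\<close>
    proof (cases "bellman M s y = y")
      case True
      with s show ?thesis
        by (auto simp: local_game_def local_price_def local_succ_def \<Psi>_def)
    next
      case False
      show ?thesis
      proof (cases "s \<in> terminals M")
        case True
        with s False show ?thesis
          by (intro bexI[of _ "Play Accept"])
            (auto simp: local_game_def local_price_def local_succ_def \<Psi>_def acts_def bellman_terminal min_def)
      next
        case nt: False
        with bellman_attained[OF s(2) nt, of y] False obtain a where "a \<in> actions M s"
          "bellman M s y = cost M a + measure_pmf.expectation (trans M s a) (\<lambda>s'. bellman M s' y)"
          by auto
        with s nt show ?thesis
          by (intro bexI[of _ "Play (Advance a)"])
            (auto simp: local_game_def local_price_def local_succ_def \<Psi>_def acts_def)
      qed
    qed
  qed
  then show ?thesis by (simp add: local_opt_def \<Psi>_def local_game_def)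
qed

end

section \<open>Grid distributions\<close>

text \<open>A concave \<open>f\<close> has decreasing slopes on the grid cells, and these slopes are
  the tail probabilities of the law sought: the mass at \<open>\<delta> * k\<close> is the drop in
  slope there. The slope is 1 left of 0, which gives total mass 1, and eventually 0, which gives
  finite support.\<close>

lemma exists_grid_pmf:
  fixes f :: "real \<Rightarrow> real"
  assumes "\<delta> > 0"
    and nonpos: "\<And>y. y \<le> 0 \<Longrightarrow> f y = y"
    and concave: "\<And>y. f (y - \<delta>) + f (y + \<delta>) \<le> 2 * f y"
    and const: "\<And>y. K \<le> y \<Longrightarrow> f y = C"
  shows "\<exists>q :: nat pmf. finite (set_pmf q) \<and>
    (\<forall>j. measure_pmf.expectation q (\<lambda>k. min (\<delta> * real j) (\<delta> * real k)) = f (\<delta> * real j))"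
proof -
  \<comment> \<open>The increment over the cell ending at \<open>\<delta> * k\<close>. For
    \<open>k = 0\<close> this is the cell from \<open>- \<delta>\<close> to 0, where
    \<open>f\<close> is the identity.\<close>
  define D where "D k = f (\<delta> * real k) - f (\<delta> * real k - \<delta>)" for k
  define w where "w k = (D k - D (Suc k)) / \<delta>" for k
  obtain m where m: "K \<le> \<delta> * real m"
    using \<open>\<delta> > 0\<close> by (metis reals_Archimedean3 less_imp_le mult.commute)
  have D_zero: "D k = 0" if "k > m" for k
  proof -
    have "\<delta> * real m \<le> \<delta> * real k - \<delta>"
      using that \<open>\<delta> > 0\<close> mult_left_mono[of "real (Suc m)" "real k" \<delta>] by (simp add: algebra_simps)
    with m \<open>\<delta> > 0\<close> const show ?thesis by (simp add: D_def)
  qed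
  have D0: "D 0 = \<delta>" using nonpos[of 0] nonpos[of "- \<delta>"] \<open>\<delta> > 0\<close> by (simp add: D_def)
  have w_nonneg: "0 \<le> w k" for k
    using concave[of "\<delta> * real k"] \<open>\<delta> > 0\<close> by (simp add: w_def D_def algebra_simps)
  have w_zero: "w k = 0" if "k > m" for k using D_zero that by (simp add: w_def)
  \<comment> \<open>Telescoping: the probability of an index at least \<open>j\<close> is the slope
    of \<open>f\<close> on the cell ending at \<open>\<delta> * j\<close>.\<close>
  have tail: "(\<Sum>k=j..m. w k) = D j / \<delta>" for j
  proof (cases "j \<le> Suc m")
    case True
    have "(\<Sum>k=j..m. w k) = (\<Sum>k=j..m. (- D (Suc k)) - (- D k)) / \<delta>"
      by (simp add: w_def sum_divide_distrib)
    also have "\<dots> = D j / \<delta>"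
      using sum_Suc_diff[OF True, of "\<lambda>k. - D k"] D_zero by simp
    finally show ?thesis .
  next
    case False
    then show ?thesis using D_zero by simp
  qed
  have "(\<integral>\<^sup>+k. ennreal (w k) \<partial>count_space UNIV) = (\<Sum>k\<in>{..m}. ennreal (w k))"
    using w_zero by (intro nn_integral_count_space') (auto simp: not_le)
  also have "\<dots> = ennreal (\<Sum>k=0..m. w k)"
    using w_nonneg by (simp add: sum_ennreal atMost_atLeast0)
  also have "\<dots> = 1" using tail[of 0] D0 \<open>\<delta> > 0\<close> by simp
  finally have w_sum: "(\<integral>\<^sup>+k. ennreal (w k) \<partial>count_space UNIV) = 1" .
  define q where "q = embed_pmf w"
  have pmf_q: "pmf q k = w k" for k
    unfolding q_def using w_nonneg w_sum by (intro pmf_embed_pmf)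
  have set_q: "set_pmf q \<subseteq> {0..m}"
    using pmf_q w_zero by (auto simp: set_pmf_eq) (meson not_le)
  then have fin: "finite (set_pmf q)" using finite_subset by blast
  have "measure_pmf.expectation q (\<lambda>k. min (\<delta> * real j) (\<delta> * real k)) = f (\<delta> * real j)" for j
  proof (induction j)
    case 0
    then show ?case using nonpos[of 0] \<open>\<delta> > 0\<close> by (simp add: min_def)
  next
    case (Suc j)
    \<comment> \<open>Raising the cap by one cell adds \<delta> exactly when \<open>k\<close>
      exceeds \<open>j\<close>; in expectation this is \<delta> times a tail probability, hence the
      increment of \<open>f\<close>.\<close>
    have "min (\<delta> * real (Suc j)) (\<delta> * real k) =
        min (\<delta> * real j) (\<delta> * real k) + (if j < k then \<delta> else 0)" for k
    proof (cases "j < k")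
      case True
      then have "\<delta> * real (Suc j) \<le> \<delta> * real k" "\<delta> * real j \<le> \<delta> * real k"
        using \<open>\<delta> > 0\<close> by (intro mult_left_mono; simp)+
      then show ?thesis using True by (simp add: algebra_simps)
    next
      case False
      then have "\<delta> * real k \<le> \<delta> * real (Suc j)" "\<delta> * real k \<le> \<delta> * real j"
        using \<open>\<delta> > 0\<close> by (intro mult_left_mono; simp)+
      then show ?thesis using False by (simp add: min_absorb2)
    qed
    then have "measure_pmf.expectation q (\<lambda>k. min (\<delta> * real (Suc j)) (\<delta> * real k)) =
        measure_pmf.expectation q (\<lambda>k. min (\<delta> * real j) (\<delta> * real k)) +
        measure_pmf.expectation q (\<lambda>k. if j < k then \<delta> else 0)"
      by (simp only: Bochner_Integration.integral_add[OF integrable_measure_pmf_finite[OF fin]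
        integrable_measure_pmf_finite[OF fin]])
    also have "measure_pmf.expectation q (\<lambda>k. if j < k then \<delta> else 0) = (\<Sum>k=Suc j..m. \<delta> * w k)"
      using set_q by (subst integral_measure_pmf_real[of "{Suc j..m}"]) (auto simp: pmf_q split: if_splits)
    also have "\<dots> = D (Suc j)"
      using tail[of "Suc j"] \<open>\<delta> > 0\<close> by (simp add: sum_distrib_left[symmetric])
    finally show ?case using Suc by (simp add: D_def algebra_simps)
  qed
  with fin show ?thesis by blast
qed

text \<open>The only kink of \<open>min \<theta> (\<delta> * real k)\<close> in \<theta> sits at a
  grid point, so the function is linear on the cell containing \<theta>; \<open>t\<close> is the
  relative position of \<theta> in that cell.\<close>

lemma min_grid_interpolation:
  fixes \<theta> \<delta> :: real
  assumes "\<delta> > 0" "0 \<le> \<theta>"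
  defines "j \<equiv> nat \<lfloor>\<theta> / \<delta>\<rfloor>" and "t \<equiv> \<theta> / \<delta> - real (nat \<lfloor>\<theta> / \<delta>\<rfloor>)"
  shows "min \<theta> (\<delta> * real k) =
      (1 - t) * min (\<delta> * real j) (\<delta> * real k) + t * min (\<delta> * real (Suc j)) (\<delta> * real k)"
    and "0 \<le> t" "t \<le> 1"
proof -
  have nn: "0 \<le> \<theta> / \<delta>" using assms by simp
  have j: "real j \<le> \<theta> / \<delta>" "\<theta> / \<delta> < real j + 1"
    using nn unfolding j_def by linarith+
  then show t: "0 \<le> t" "t \<le> 1" unfolding t_def j_def[symmetric] by auto
  have \<theta>: "\<theta> = \<delta> * (real j + t)" using \<open>\<delta> > 0\<close> by (simp add: t_def j_def)
  show "min \<theta> (\<delta> * real k) =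
      (1 - t) * min (\<delta> * real j) (\<delta> * real k) + t * min (\<delta> * real (Suc j)) (\<delta> * real k)"
  proof (cases "k \<le> j")
    case True
    then have "\<delta> * real k \<le> \<delta> * real j" "\<delta> * real k \<le> \<delta> * real (Suc j)" "\<delta> * real k \<le> \<theta>"
      unfolding \<theta> using \<open>\<delta> > 0\<close> t by (intro mult_left_mono; simp)+
    then show ?thesis by (simp add: min_absorb2 algebra_simps)
  next
    case False
    then have "\<delta> * real j \<le> \<delta> * real k" "\<delta> * real (Suc j) \<le> \<delta> * real k" "\<theta> \<le> \<delta> * real k"
      unfolding \<theta> using \<open>\<delta> > 0\<close> t by (intro mult_left_mono; simp)+
    then have "min (\<delta> * real j) (\<delta> * real k) = \<delta> * real j"
      "min (\<delta> * real (Suc j)) (\<delta> * real k) = \<delta> * real (Suc j)" "min \<theta> (\<delta> * real k) = \<theta>"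
      by (simp_all only: min_absorb1)
    then show ?thesis using \<theta> by (simp add: algebra_simps)
  qed
qed

lemma expectation_grid_interpolation:
  fixes q :: "nat pmf"
  assumes "\<delta> > 0" "0 \<le> \<theta>" "finite (set_pmf q)"
  shows "measure_pmf.expectation q (\<lambda>k. min \<theta> (\<delta> * real k)) =
    (1 - (\<theta> / \<delta> - real (nat \<lfloor>\<theta> / \<delta>\<rfloor>))) *
      measure_pmf.expectation q (\<lambda>k. min (\<delta> * real (nat \<lfloor>\<theta> / \<delta>\<rfloor>)) (\<delta> * real k)) +
    (\<theta> / \<delta> - real (nat \<lfloor>\<theta> / \<delta>\<rfloor>)) *
      measure_pmf.expectation q (\<lambda>k. min (\<delta> * real (Suc (nat \<lfloor>\<theta> / \<delta>\<rfloor>))) (\<delta> * real k))"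
  unfolding min_grid_interpolation(1)[OF assms(1,2)]
  using assms(3) by (subst Bochner_Integration.integral_add) (auto intro!: integrable_measure_pmf_finite)

lemma expectation_grid_nonpos:
  fixes q :: "nat pmf"
  assumes "\<delta> > 0" "\<theta> \<le> 0"
  shows "measure_pmf.expectation q (\<lambda>k. min \<theta> (\<delta> * real k)) = \<theta>"
proof -
  have "min \<theta> (\<delta> * real k) = \<theta>" for k
    using assms by (intro min_absorb1) (auto intro: order_trans)
  then show ?thesis by simp
qed

text \<open>On the grid both sides are linear between grid points, so it suffices to compare there.\<close>

lemma grid_domination:
  fixes q :: "nat pmf" and r :: "'s \<Rightarrow> nat pmf"
  assumes \<delta>: "\<delta> > 0" and "0 \<le> c" and fin: "finite (set_pmf q)" "finite (set_pmf p)"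
    and fin': "\<And>s. s \<in> set_pmf p \<Longrightarrow> finite (set_pmf (r s))"
    and grid: "\<And>j. measure_pmf.expectation q (\<lambda>k. min (\<delta> * real j) (\<delta> * real k)) \<le>
      c + measure_pmf.expectation p (\<lambda>s. measure_pmf.expectation (r s) (\<lambda>k. min (\<delta> * real j) (\<delta> * real k)))"
  shows "measure_pmf.expectation q (\<lambda>k. min \<theta> (\<delta> * real k)) \<le>
      c + measure_pmf.expectation p (\<lambda>s. measure_pmf.expectation (r s) (\<lambda>k. min \<theta> (\<delta> * real k)))"
\<comment> \<open>Below 0 the cap always binds: the left side is \<theta> and the right side is
  \<open>c + \<theta>\<close>.\<close>
proof (cases "\<theta> \<le> 0")
  case True
  then show ?thesis using \<open>0 \<le> c\<close> by (simp add: expectation_grid_nonpos[OF \<delta>])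
next
  case False
  then have \<theta>: "0 \<le> \<theta>" by simp
  define j where "j = nat \<lfloor>\<theta> / \<delta>\<rfloor>"
  define t where "t = \<theta> / \<delta> - real (nat \<lfloor>\<theta> / \<delta>\<rfloor>)"
  note interp = expectation_grid_interpolation[OF \<delta> \<theta>, folded t_def, folded j_def]
  have t: "0 \<le> t" "t \<le> 1" using min_grid_interpolation(2,3)[OF \<delta> \<theta>] by (simp_all add: t_def)
  let ?h = "\<lambda>x q. measure_pmf.expectation q (\<lambda>k :: nat. min x (\<delta> * real k))"
  have "?h \<theta> q = (1 - t) * ?h (\<delta> * real j) q + t * ?h (\<delta> * real (Suc j)) q"
    by (rule interp[OF fin(1)])
  also have "\<dots> \<le> (1 - t) * (c + measure_pmf.expectation p (\<lambda>s. ?h (\<delta> * real j) (r s))) +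
      t * (c + measure_pmf.expectation p (\<lambda>s. ?h (\<delta> * real (Suc j)) (r s)))"
    using t by (intro add_mono mult_left_mono grid) auto
  also have "\<dots> = c + ((1 - t) * measure_pmf.expectation p (\<lambda>s. ?h (\<delta> * real j) (r s)) +
      t * measure_pmf.expectation p (\<lambda>s. ?h (\<delta> * real (Suc j)) (r s)))"
    by (simp add: algebra_simps)
  also have "(1 - t) * measure_pmf.expectation p (\<lambda>s. ?h (\<delta> * real j) (r s)) +
      t * measure_pmf.expectation p (\<lambda>s. ?h (\<delta> * real (Suc j)) (r s)) =
      measure_pmf.expectation p (\<lambda>s. (1 - t) * ?h (\<delta> * real j) (r s) + t * ?h (\<delta> * real (Suc j)) (r s))"
    using fin(2) by (subst Bochner_Integration.integral_add) (auto intro!: integrable_measure_pmf_finite)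
  also have "\<dots> = measure_pmf.expectation p (\<lambda>s. ?h \<theta> (r s))"
    using fin' by (intro expectation_cong_set_pmf) (simp only: interp)
  finally show ?thesis .
qed

section \<open>Laws of element weights\<close>

definition weight_law :: "real measure \<Rightarrow> bool" where
  "weight_law \<mu> \<longleftrightarrow> prob_space \<mu> \<and> sets \<mu> = sets borel \<and> integrable \<mu> (\<lambda>x. x)"

definition grid_law :: "real \<Rightarrow> nat pmf \<Rightarrow> real measure" where
  "grid_law \<delta> q = distr (measure_pmf q) borel (\<lambda>k. \<delta> * real k)"

lemma weight_law_grid_law: "finite (set_pmf q) \<Longrightarrow> weight_law (grid_law \<delta> q)"
  unfolding weight_law_def grid_law_def
  by (auto intro!: measure_pmf.prob_space_distr simp: integrable_distr_eq integrable_measure_pmf_finite)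

lemma integral_grid_law:
  "f \<in> borel_measurable borel \<Longrightarrow>
    (\<integral>x. f x \<partial>grid_law \<delta> q) = measure_pmf.expectation q (\<lambda>k. f (\<delta> * real k) :: real)"
  unfolding grid_law_def by (intro integral_distr) auto

lemma weight_law_measurable: "weight_law \<mu> \<Longrightarrow> f \<in> borel_measurable borel \<Longrightarrow> f \<in> borel_measurable \<mu>"
  unfolding weight_law_def using measurable_cong_sets by blast

lemma weight_law_integrable_min:
  assumes "weight_law \<mu>"
  shows "integrable \<mu> (\<lambda>x. min \<theta> x)"
proof -
  interpret prob_space \<mu> using assms by (simp add: weight_law_def)
  show ?thesis using assms by (intro integrable_min) (auto simp: weight_law_def)
qed

lemma tendsto_integral_min:
  assumes "weight_law \<mu>"
  shows "(\<lambda>n. \<integral>x. min (real n) x \<partial>\<mu>) \<longlonglongrightarrow> (\<integral>x. x \<partial>\<mu>)"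
proof (rule integral_dominated_convergence[where w = "\<lambda>x. \<bar>x\<bar>"])
  show "AE x in \<mu>. (\<lambda>n. min (real n) x) \<longlonglongrightarrow> x"
  proof (rule AE_I2)
    fix x :: real
    show "(\<lambda>n. min (real n) x) \<longlonglongrightarrow> x"
      by (intro tendsto_eventually eventually_sequentiallyI[of "nat \<lceil>x\<rceil>"]) linarith
  qed
  show "AE x in \<mu>. norm (min (real i) x) \<le> \<bar>x\<bar>" for i
    by (rule AE_I2) auto
  show "integrable \<mu> (\<lambda>x. \<bar>x\<bar>)" using assms by (simp add: weight_law_def)
qed (rule weight_law_measurable[OF assms], measurable)+

text \<open>The cap \<theta> is sent to infinity along the naturals; the expectation over
  \<open>p\<close> is a finite sum, so limits pass through it.\<close>

lemma dominated_mean: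
  assumes \<mu>: "weight_law \<mu>" and \<nu>: "\<And>s. s \<in> set_pmf p \<Longrightarrow> weight_law (\<nu> s)"
    and fin: "finite (set_pmf p)"
    and dom: "\<And>\<theta>. (\<integral>x. min \<theta> x \<partial>\<mu>) \<le> c + measure_pmf.expectation p (\<lambda>s. \<integral>x. min \<theta> x \<partial>\<nu> s)"
  shows "(\<integral>x. x \<partial>\<mu>) \<le> c + measure_pmf.expectation p (\<lambda>s. \<integral>x. x \<partial>\<nu> s)"
proof (rule LIMSEQ_le)
  show "(\<lambda>n. \<integral>x. min (real n) x \<partial>\<mu>) \<longlonglongrightarrow> (\<integral>x. x \<partial>\<mu>)" by (rule tendsto_integral_min[OF \<mu>])
  have eq: "measure_pmf.expectation p g = (\<Sum>s\<in>set_pmf p. g s * pmf p s)" for g :: "_ \<Rightarrow> real"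
    using fin by (intro integral_measure_pmf_real) auto
  show "(\<lambda>n. c + measure_pmf.expectation p (\<lambda>s. \<integral>x. min (real n) x \<partial>\<nu> s)) \<longlonglongrightarrow>
      c + measure_pmf.expectation p (\<lambda>s. \<integral>x. x \<partial>\<nu> s)"
    unfolding eq by (intro tendsto_intros tendsto_integral_min \<nu>)
qed (use dom in blast)

text \<open>Capped means control every function that can arise as the completion cost in one weight:
  the summand \<open>b\<close> occurs equally on both sides because all measures have mass 1, and
  the uncapped case is the limit of the capped ones.\<close>

lemma dominated_transfer:
  assumes \<mu>: "weight_law \<mu>" and \<nu>: "\<And>s. s \<in> set_pmf p \<Longrightarrow> weight_law (\<nu> s)"
    and fin: "finite (set_pmf p)"
    and dom: "\<And>\<theta>. (\<integral>x. min \<theta> x \<partial>\<mu>) \<le> c + measure_pmf.expectation p (\<lambda>s. \<integral>x. min \<theta> x \<partial>\<nu> s)"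
    and g: "(\<forall>u. g u = b + u) \<or> (\<forall>u. g u = b + min a u)"
  shows "(\<integral>x. g x \<partial>\<mu>) \<le> c + measure_pmf.expectation p (\<lambda>s. \<integral>x. g x \<partial>\<nu> s)"
proof -
  have shift: "(\<integral>x. b + f x \<partial>\<mu>) \<le> c + measure_pmf.expectation p (\<lambda>s. \<integral>x. b + f x \<partial>\<nu> s)"
    if le: "(\<integral>x. f x \<partial>\<mu>) \<le> c + measure_pmf.expectation p (\<lambda>s. \<integral>x. f x \<partial>\<nu> s)"
      and int: "\<And>\<mu>. weight_law \<mu> \<Longrightarrow> integrable \<mu> f" for f :: "real \<Rightarrow> real"
  proof -
    have add: "(\<integral>x. b + f x \<partial>\<mu>) = b + (\<integral>x. f x \<partial>\<mu>)" if "weight_law \<mu>" for \<mu>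
    proof -
      interpret prob_space \<mu> using that by (simp add: weight_law_def)
      show ?thesis using int[OF that] by (simp add: prob_space)
    qed
    have "measure_pmf.expectation p (\<lambda>s. \<integral>x. b + f x \<partial>\<nu> s) =
        measure_pmf.expectation p (\<lambda>s. b + (\<integral>x. f x \<partial>\<nu> s))"
      by (intro expectation_cong_set_pmf add \<nu>)
    also have "\<dots> = b + measure_pmf.expectation p (\<lambda>s. \<integral>x. f x \<partial>\<nu> s)"
      using fin by (subst Bochner_Integration.integral_add) (auto intro: integrable_measure_pmf_finite)
    finally show ?thesis using le add[OF \<mu>] by simp
  qed
  from g show ?thesis
  proof
    assume "\<forall>u. g u = b + u"
    then have "g = (\<lambda>u. b + u)" by auto
    then show ?thesis
      using shift[OF dominated_mean[OF \<mu> \<nu> fin dom]] by (simp add: weight_law_def)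
  next
    assume "\<forall>u. g u = b + min a u"
    then have "g = (\<lambda>u. b + min a u)" by auto
    then show ?thesis using shift[OF dom weight_law_integrable_min] by simp
  qed
qed

section \<open>The cost of completing a set to a feasible one\<close>

locale feasible_sets =
  fixes E :: "'i set" and \<F> :: "'i set set"
  assumes finite_E: "finite E" and sub_E: "\<F> \<subseteq> Pow E" and E_feasible: "E \<in> \<F>"
begin

text \<open>Only elements outside \<open>S\<close> are charged, since accepted ones have been paid
  for. For \<open>S = {}\<close> this is the minimum whose expectation appears in the bound.\<close>

definition completion_cost :: "'i set \<Rightarrow> ('i \<Rightarrow> real) \<Rightarrow> real" where
  "completion_cost S w = Min ((\<lambda>T. \<Sum>i\<in>T - S. w i) ` {T \<in> \<F>. S \<subseteq> T})"

lemma finite_completions: "finite {T \<in> \<F>. P T}"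
  using finite_E sub_E by (auto intro: finite_subset[OF _ finite_Pow_iff[THEN iffD2]])

lemma completion_cost_le:
  "T \<in> \<F> \<Longrightarrow> S \<subseteq> T \<Longrightarrow> completion_cost S w \<le> (\<Sum>i\<in>T - S. w i)"
  unfolding completion_cost_def using finite_completions by (intro Min_le) auto

lemma completion_cost_attained:
  assumes "S \<subseteq> E"
  obtains T where "T \<in> \<F>" "S \<subseteq> T" "completion_cost S w = (\<Sum>i\<in>T - S. w i)"
proof -
  have "completion_cost S w \<in> (\<lambda>T. \<Sum>i\<in>T - S. w i) ` {T \<in> \<F>. S \<subseteq> T}"
    unfolding completion_cost_def using finite_completions E_feasible assms by (intro Min_in) auto
  then show ?thesis using that by blast
qed

text \<open>The set \<open>S\<close> completes itself at no charge. Negative weights may make a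
  larger set cheaper still, hence only an inequality.\<close>

lemma completion_cost_nonpos: "S \<in> \<F> \<Longrightarrow> completion_cost S w \<le> 0"
  using completion_cost_le[of S S w] by simp

lemma completion_cost_insert:
  assumes "S \<subseteq> E" "i \<in> E - S"
  shows "completion_cost S w \<le> w i + completion_cost (insert i S) w"
proof -
  obtain T where T: "T \<in> \<F>" "insert i S \<subseteq> T"
    "completion_cost (insert i S) w = (\<Sum>j\<in>T - insert i S. w j)"
    using completion_cost_attained[of "insert i S" w] assms by auto
  have "finite T" using T(1) sub_E finite_E finite_subset by blast
  then have "(\<Sum>j\<in>T - S. w j) = w i + (\<Sum>j\<in>T - insert i S. w j)"
    using T(2) assms by (subst sum.remove[of _ i]) (auto intro!: sum.cong)
  with completion_cost_le[OF T(1), of S w] T show ?thesis by auto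
qed

lemma abs_completion_cost_le:
  assumes "S \<subseteq> E"
  shows "\<bar>completion_cost S w\<bar> \<le> (\<Sum>i\<in>E. \<bar>w i\<bar>)"
proof -
  obtain T where T: "T \<in> \<F>" "S \<subseteq> T" "completion_cost S w = (\<Sum>i\<in>T - S. w i)"
    by (rule completion_cost_attained[OF assms])
  have "\<bar>completion_cost S w\<bar> \<le> (\<Sum>i\<in>T - S. \<bar>w i\<bar>)" using T(3) by (simp add: sum_abs)
  also have "\<dots> \<le> (\<Sum>i\<in>E. \<bar>w i\<bar>)" using T(1) sub_E finite_E by (intro sum_mono2) auto
  finally show ?thesis .
qed

lemma completion_cost_cong:
  assumes "\<And>i. i \<in> E \<Longrightarrow> w i = w' i"
  shows "completion_cost S w = completion_cost S w'"
  unfolding completion_cost_def using assms sub_E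
  by (intro arg_cong[where f = Min] image_cong sum.cong) auto

text \<open>Either element \<open>i\<close> is indispensable, or it competes with the best completion avoiding it.\<close>

lemma completion_cost_coordinate:
  assumes "S \<subseteq> E" "i \<in> E - S"
  shows "\<exists>b a. (\<forall>u. completion_cost S (w(i := u)) = b + u) \<or>
    (\<forall>u. completion_cost S (w(i := u)) = b + min a u)"
proof -
  let ?A = "{T \<in> \<F>. S \<subseteq> T \<and> i \<in> T}" and ?B = "{T \<in> \<F>. S \<subseteq> T \<and> i \<notin> T}"
  define b where "b = Min ((\<lambda>T. \<Sum>j\<in>T - S - {i}. w j) ` ?A)"
  \<comment> \<open>The full set is a completion using \<open>i\<close>, so the minimum defining
    \<open>b\<close> ranges over a nonempty family; the family \<open>?B\<close> avoiding
    \<open>i\<close> may be empty.\<close>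
  have "E \<in> ?A" using assms E_feasible by auto
  have with_i: "Min ((\<lambda>T. \<Sum>j\<in>T - S. (w(i := u)) j) ` ?A) = b + u" for u
  proof -
    have "(\<Sum>j\<in>T - S. (w(i := u)) j) = (\<Sum>j\<in>T - S - {i}. w j) + u" if "T \<in> ?A" for T
    proof -
      have "finite T" using that sub_E finite_E finite_subset by blast
      then show ?thesis using that assms by (subst sum.remove[of _ i]) (auto intro!: sum.cong)
    qed
    then have "Min ((\<lambda>T. \<Sum>j\<in>T - S. (w(i := u)) j) ` ?A) =
        Min ((\<lambda>T. (\<Sum>j\<in>T - S - {i}. w j) + u) ` ?A)"
      by (intro arg_cong[where f = Min] image_cong) auto
    also have "\<dots> = b + u"
      unfolding b_def using \<open>E \<in> ?A\<close> finite_completions by (intro Min_add_commute) auto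
    finally show ?thesis .
  qed
  have without_i: "(\<lambda>T. \<Sum>j\<in>T - S. (w(i := u)) j) ` ?B = (\<lambda>T. \<Sum>j\<in>T - S. w j) ` ?B" for u
    by (intro image_cong sum.cong) auto
  have split: "{T \<in> \<F>. S \<subseteq> T} = ?A \<union> ?B" by auto
  show ?thesis
  proof (cases "?B = {}")
    case True
    then have "completion_cost S (w(i := u)) = b + u" for u
      using with_i by (simp only: completion_cost_def split Un_empty_right)
    then show ?thesis by blast
  next
    case False
    \<comment> \<open>The threshold weight at which using \<open>i\<close> and avoiding it cost the
      same.\<close>
    define a where "a = Min ((\<lambda>T. \<Sum>j\<in>T - S. w j) ` ?B) - b"
    have "completion_cost S (w(i := u)) = b + min a u" for u
    proof -
      have "completion_cost S (w(i := u)) = min (b + u) (Min ((\<lambda>T. \<Sum>j\<in>T - S. w j) ` ?B))"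
        unfolding completion_cost_def split image_Un
        using False \<open>E \<in> ?A\<close> finite_completions
        by (subst Min_Un) (auto simp only: with_i without_i finite_imageI image_is_empty)
      then show ?thesis by (simp add: a_def min_def)
    qed
    then show ?thesis by blast
  qed
qed

lemma completion_cost_measurable:
  assumes "\<And>i. i \<in> E \<Longrightarrow> sets (\<mu> i) = sets borel"
  shows "completion_cost S \<in> borel_measurable (Pi\<^sub>M E \<mu>)"
proof -
  have "(\<lambda>w. w i) \<in> borel_measurable (Pi\<^sub>M E \<mu>)" if "i \<in> E" for i
    using measurable_component_singleton[OF that, of \<mu>] measurable_cong_sets[OF refl assms[OF that]]
    by blast
  then show ?thesis
    unfolding completion_cost_def[abs_def] using sub_E finite_completions
    by (intro borel_measurable_Min borel_measurable_sum) auto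
qed

end

section \<open>Replacing the law of a single weight\<close>

lemma integrable_PiM_coordinate:
  fixes \<mu> :: "'i \<Rightarrow> real measure"
  assumes "\<And>i. weight_law (\<mu> i)" "i \<in> I"
  shows "integrable (Pi\<^sub>M I \<mu>) (\<lambda>w. w i)"
proof -
  have p: "\<And>i. prob_space (\<mu> i)" using assms(1) by (simp add: weight_law_def)
  have "integrable (distr (Pi\<^sub>M I \<mu>) (\<mu> i) (\<lambda>w. w i)) (\<lambda>x. x)"
    using distr_PiM_component[of I \<mu> i] p assms(2) assms(1)[of i] by (simp add: weight_law_def)
  then show ?thesis
    by (rule integrable_distr[OF measurable_component_singleton[OF assms(2)]])
qed

context feasible_sets
begin

lemma integrable_completion_cost:
  assumes "\<And>i. weight_law (\<mu> i)" "S \<subseteq> E"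
  shows "integrable (Pi\<^sub>M E \<mu>) (completion_cost S)"
proof (rule Bochner_Integration.integrable_bound)
  show "integrable (Pi\<^sub>M E \<mu>) (\<lambda>w. \<Sum>i\<in>E. \<bar>w i\<bar>)"
    by (intro Bochner_Integration.integrable_sum integrable_abs integrable_PiM_coordinate assms)
  show "completion_cost S \<in> borel_measurable (Pi\<^sub>M E \<mu>)"
    using assms(1) by (intro completion_cost_measurable) (simp add: weight_law_def)
  show "AE w in Pi\<^sub>M E \<mu>. norm (completion_cost S w) \<le> norm (\<Sum>i\<in>E. \<bar>w i\<bar>)"
    using abs_completion_cost_le[OF assms(2)] by (intro AE_I2) (simp add: abs_of_nonneg sum_nonneg)
qed

text \<open>Fubini with coordinate \<open>i\<close> integrated innermost. Integrability of the inner
  integral follows from the bound of the completion cost by the sum of absolute weights.\<close>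

lemma integral_completion_cost_split:
  assumes \<mu>: "\<And>i. weight_law (\<mu> i)" and S: "S \<subseteq> E" and i: "i \<in> E - S"
  shows "(\<integral>w. completion_cost S w \<partial>Pi\<^sub>M E \<mu>) =
      (\<integral>w. (\<integral>u. completion_cost S (w(i := u)) \<partial>\<mu> i) \<partial>Pi\<^sub>M (E - {i}) \<mu>)"
    and "integrable (Pi\<^sub>M (E - {i}) \<mu>) (\<lambda>w. \<integral>u. completion_cost S (w(i := u)) \<partial>\<mu> i)"
proof -
  have p: "prob_space (\<mu> j)" for j using \<mu> by (simp add: weight_law_def)
  interpret product_sigma_finite \<mu>
    by (simp add: product_sigma_finite_def prob_space_imp_sigma_finite p)
  interpret \<mu>i: prob_space "\<mu> i" by (rule p)
  have E: "E = insert i (E - {i})" using i by auto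
  show "(\<integral>w. completion_cost S w \<partial>Pi\<^sub>M E \<mu>) =
      (\<integral>w. (\<integral>u. completion_cost S (w(i := u)) \<partial>\<mu> i) \<partial>Pi\<^sub>M (E - {i}) \<mu>)"
    using product_integral_insert[of "E - {i}" i "completion_cost S"] finite_E
      integrable_completion_cost[OF \<mu> S] E by simp
  have meas: "completion_cost S \<in> borel_measurable (Pi\<^sub>M E \<mu>)"
    using integrable_completion_cost[OF \<mu> S] by simp
  have pair: "(\<lambda>(w, u). completion_cost S (w(i := u))) \<in>
      borel_measurable (Pi\<^sub>M (E - {i}) \<mu> \<Otimes>\<^sub>M \<mu> i)"
    using measurable_compose[OF measurable_add_dim[of i "E - {i}" \<mu>], folded E, OF meas]
    by (simp add: split_beta')
  let ?bound = "\<lambda>w. (\<Sum>j\<in>E - {i}. \<bar>w j\<bar>) + (\<integral>u. \<bar>u\<bar> \<partial>\<mu> i)"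
  show "integrable (Pi\<^sub>M (E - {i}) \<mu>) (\<lambda>w. \<integral>u. completion_cost S (w(i := u)) \<partial>\<mu> i)"
  proof (rule Bochner_Integration.integrable_bound)
    interpret rest: prob_space "Pi\<^sub>M (E - {i}) \<mu>" by (intro prob_space_PiM p)
    show "integrable (Pi\<^sub>M (E - {i}) \<mu>) ?bound"
      by (intro Bochner_Integration.integrable_add Bochner_Integration.integrable_sum integrable_abs
          integrable_PiM_coordinate \<mu>) auto
    show "(\<lambda>w. \<integral>u. completion_cost S (w(i := u)) \<partial>\<mu> i) \<in> borel_measurable (Pi\<^sub>M (E - {i}) \<mu>)"
      by (rule sigma_finite_measure.borel_measurable_lebesgue_integral
          [OF prob_space_imp_sigma_finite[OF p] pair])
    show "AE w in Pi\<^sub>M (E - {i}) \<mu>. norm (\<integral>u. completion_cost S (w(i := u)) \<partial>\<mu> i) \<le> norm (?bound w)"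
    proof (rule AE_I2)
      fix w
      have abs_int: "integrable (\<mu> i) (\<lambda>u. \<bar>u\<bar>)" using \<mu>[of i] by (simp add: weight_law_def)
      have "norm (\<integral>u. completion_cost S (w(i := u)) \<partial>\<mu> i) \<le>
          (\<integral>u. (\<Sum>j\<in>E - {i}. \<bar>w j\<bar>) + \<bar>u\<bar> \<partial>\<mu> i)"
        unfolding real_norm_def
      proof (rule integral_abs_bound_integral)
        \<comment> \<open>The coordinate form reduces this to integrability of \<open>u\<close> and
          of \<open>min a u\<close>, for every fixed choice of the other weights.\<close>
        show "integrable (\<mu> i) (\<lambda>u. completion_cost S (w(i := u)))"
          using completion_cost_coordinate[OF S i, of w] \<mu>[of i] weight_law_integrable_min[OF \<mu>[of i]]
          by (auto simp: weight_law_def)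
        show "integrable (\<mu> i) (\<lambda>u. (\<Sum>j\<in>E - {i}. \<bar>w j\<bar>) + \<bar>u\<bar>)" using abs_int by simp
        fix u
        have "\<bar>completion_cost S (w(i := u))\<bar> \<le> (\<Sum>j\<in>E. \<bar>(w(i := u)) j\<bar>)"
          by (rule abs_completion_cost_le[OF S])
        also have "\<dots> = (\<Sum>j\<in>E - {i}. \<bar>w j\<bar>) + \<bar>u\<bar>"
          using finite_E i by (subst sum.remove[of _ i]) auto
        finally show "\<bar>completion_cost S (w(i := u))\<bar> \<le> (\<Sum>j\<in>E - {i}. \<bar>w j\<bar>) + \<bar>u\<bar>" .
      qed
      also have "\<dots> = ?bound w" using abs_int by (simp add: \<mu>i.prob_space)
      also have "\<dots> \<le> norm (?bound w)" by simp
      finally show "norm (\<integral>u. completion_cost S (w(i := u)) \<partial>\<mu> i) \<le> norm (?bound w)" .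
    qed
  qed
qed

text \<open>With all other weights frozen, the completion cost depends on the weight of
  \<open>i\<close> in one of the two controlled ways, so the domination transfers pointwise.
  Integrating over the other weights and exchanging with the finite sum over \<open>p\<close> gives
  the claim.\<close>

lemma replace_coordinate:
  assumes \<mu>: "\<And>j. weight_law (\<mu> j)" and \<nu>: "\<And>s. s \<in> set_pmf p \<Longrightarrow> weight_law (\<nu> s)"
    and fin: "finite (set_pmf p)" and S: "S \<subseteq> E" and i: "i \<in> E - S"
    and dom: "\<And>\<theta>. (\<integral>x. min \<theta> x \<partial>\<mu> i) \<le> c + measure_pmf.expectation p (\<lambda>s. \<integral>x. min \<theta> x \<partial>\<nu> s)"
  shows "(\<integral>w. completion_cost S w \<partial>Pi\<^sub>M E \<mu>) \<le>
    c + measure_pmf.expectation p (\<lambda>s. \<integral>w. completion_cost S w \<partial>Pi\<^sub>M E (\<mu>(i := \<nu> s)))"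
proof -
  let ?R = "Pi\<^sub>M (E - {i}) \<mu>"
  let ?g = "\<lambda>s w. \<integral>u. completion_cost S (w(i := u)) \<partial>\<nu> s"
  interpret rest: prob_space ?R using \<mu> by (intro prob_space_PiM) (simp add: weight_law_def)
  have law: "weight_law ((\<mu>(i := \<nu> s)) j)" if "s \<in> set_pmf p" for s j
    using \<mu> \<nu>[OF that] by simp
  \<comment> \<open>The remaining coordinates do not see the new law at \<open>i\<close>, so all the
    mixtures share one outer measure.\<close>
  have R: "Pi\<^sub>M (E - {i}) (\<mu>(i := \<nu> s)) = ?R" for s
    by (intro PiM_cong) auto
  have split: "(\<integral>w. completion_cost S w \<partial>Pi\<^sub>M E (\<mu>(i := \<nu> s))) = (\<integral>w. ?g s w \<partial>?R)"
    and int: "integrable ?R (?g s)" if "s \<in> set_pmf p" for s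
    using integral_completion_cost_split[of "\<mu>(i := \<nu> s)", OF law[OF that] S i] unfolding R by simp_all
  have sum_p: "measure_pmf.expectation p f = (\<Sum>s\<in>set_pmf p. f s * pmf p s)" for f :: "_ \<Rightarrow> real"
    using fin by (intro integral_measure_pmf_real) auto
  have int_sum: "integrable ?R (\<lambda>w. \<Sum>s\<in>set_pmf p. ?g s w * pmf p s)"
    using int by (intro Bochner_Integration.integrable_sum integrable_mult_left) auto
  have "(\<integral>w. completion_cost S w \<partial>Pi\<^sub>M E \<mu>) =
      (\<integral>w. (\<integral>u. completion_cost S (w(i := u)) \<partial>\<mu> i) \<partial>?R)"
    by (rule integral_completion_cost_split(1)[OF \<mu> S i])
  also have "\<dots> \<le> (\<integral>w. c + (\<Sum>s\<in>set_pmf p. ?g s w * pmf p s) \<partial>?R)"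
  proof (rule integral_mono)
    show "integrable ?R (\<lambda>w. \<integral>u. completion_cost S (w(i := u)) \<partial>\<mu> i)"
      by (rule integral_completion_cost_split(2)[OF \<mu> S i])
    show "integrable ?R (\<lambda>w. c + (\<Sum>s\<in>set_pmf p. ?g s w * pmf p s))"
      using int_sum by simp
    fix w
    obtain a b where "(\<forall>u. completion_cost S (w(i := u)) = b + u) \<or>
        (\<forall>u. completion_cost S (w(i := u)) = b + min a u)"
      using completion_cost_coordinate[OF S i, of w] by blast
    from dominated_transfer[OF \<mu> \<nu> fin dom this]
    show "(\<integral>u. completion_cost S (w(i := u)) \<partial>\<mu> i) \<le> c + (\<Sum>s\<in>set_pmf p. ?g s w * pmf p s)"
      unfolding sum_p .
  qed
  also have "\<dots> = c + (\<Sum>s\<in>set_pmf p. (\<integral>w. ?g s w \<partial>?R) * pmf p s)"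
    using int int_sum by (simp add: rest.prob_space Bochner_Integration.integral_sum)
  also have "\<dots> = c + measure_pmf.expectation p
      (\<lambda>s. \<integral>w. completion_cost S w \<partial>Pi\<^sub>M E (\<mu>(i := \<nu> s)))"
    unfolding sum_p using split by simp
  finally show ?thesis .
qed

end

section \<open>Lower bound on the optimal cost\<close>

text \<open>Monotone convergence: the capped means increase and are bounded, so they converge. This
  makes the surrogate costs integrable, as only their capped versions are assumed to be.\<close>

lemma (in prob_space) integrable_if_capped_means_bounded:
  fixes X :: "'a \<Rightarrow> real"
  assumes X: "random_variable borel X" and int: "\<And>y. integrable M (\<lambda>\<omega>. min y (X \<omega>))"
    and bound: "\<And>y. expectation (\<lambda>\<omega>. min y (X \<omega>)) \<le> C"
  shows "integrable M X"
proof -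
  have "incseq (\<lambda>n. expectation (\<lambda>\<omega>. min (real n) (X \<omega>)))"
    using int by (intro incseq_SucI integral_mono) auto
  then obtain L where "(\<lambda>n. expectation (\<lambda>\<omega>. min (real n) (X \<omega>))) \<longlonglongrightarrow> L"
    by (rule incseq_convergent[where B = C]) (use bound in auto)
  then show ?thesis
  proof (rule integrable_monotone_convergence[rotated 3])
    show "AE \<omega> in M. mono (\<lambda>n. min (real n) (X \<omega>))" by (auto simp: mono_def)
    show "AE \<omega> in M. (\<lambda>n. min (real n) (X \<omega>)) \<longlonglongrightarrow> X \<omega>"
    proof (rule AE_I2)
      fix \<omega>
      show "(\<lambda>n. min (real n) (X \<omega>)) \<longlonglongrightarrow> X \<omega>"
        by (intro tendsto_eventually eventually_sequentiallyI[of "nat \<lceil>X \<omega>\<rceil>"]) linarith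
    qed
  qed (use int X in auto)
qed

text \<open>A cap at the largest support point has no effect, so the mean is itself one of the
  capped means.\<close>

lemma grid_mean_le:
  fixes q :: "nat pmf"
  assumes "\<delta> > 0" "finite (set_pmf q)"
    and "\<And>j. measure_pmf.expectation q (\<lambda>k. min (\<delta> * real j) (\<delta> * real k)) \<le> v"
  shows "measure_pmf.expectation q (\<lambda>k. \<delta> * real k) \<le> v"
proof -
  have "measure_pmf.expectation q (\<lambda>k. \<delta> * real k) =
      measure_pmf.expectation q (\<lambda>k. min (\<delta> * real (Max (set_pmf q))) (\<delta> * real k))"
    using assms(1,2) by (intro expectation_cong_set_pmf min_absorb2[symmetric] mult_left_mono) auto
  with assms(3) show ?thesis by simp
qed

text \<open>Rounding the cap down to the grid lowers the left side by at most \<delta>. At the grid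
  point the two laws compare through \<open>f\<close>, and restoring the cap only increases the
  right side.\<close>

lemma grid_law_approximates:
  fixes q :: "nat pmf"
  assumes \<delta>: "\<delta> > 0" and fin: "finite (set_pmf q)" and \<mu>: "weight_law \<mu>"
    and le: "\<And>\<theta>. (\<integral>x. min \<theta> x \<partial>\<mu>) \<le> f \<theta>"
    and grid: "\<And>j. measure_pmf.expectation q (\<lambda>k. min (\<delta> * real j) (\<delta> * real k)) = f (\<delta> * real j)"
  shows "(\<integral>x. min \<theta> x \<partial>\<mu>) \<le> \<delta> + (\<integral>x. min \<theta> x \<partial>grid_law \<delta> q)"
proof -
  interpret prob_space \<mu> using \<mu> by (simp add: weight_law_def)
  note int = weight_law_integrable_min[OF \<mu>]
  have grid_law: "(\<integral>x. min \<theta> x \<partial>grid_law \<delta> q) = measure_pmf.expectation q (\<lambda>k. min \<theta> (\<delta> * real k))"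
    by (rule integral_grid_law) measurable
  show ?thesis
  proof (cases "\<theta> \<le> 0")
    case True
    have "(\<integral>x. min \<theta> x \<partial>\<mu>) \<le> (\<integral>x. \<theta> \<partial>\<mu>)" by (intro integral_mono int) auto
    then show ?thesis
      using \<delta> grid_law expectation_grid_nonpos[OF \<delta> True, of q] by (simp add: prob_space)
  next
    case False
    define j where "j = nat \<lfloor>\<theta> / \<delta>\<rfloor>"
    have "0 \<le> \<theta> / \<delta>" using False \<delta> by simp
    then have "real j \<le> \<theta> / \<delta>" "\<theta> / \<delta> \<le> real j + 1" unfolding j_def by linarith+
    then have j: "\<delta> * real j \<le> \<theta>" "\<theta> \<le> \<delta> * real j + \<delta>" using \<delta> by (simp_all add: field_simps)
    have "(\<integral>x. min \<theta> x \<partial>\<mu>) \<le> (\<integral>x. min (\<delta> * real j) x + \<delta> \<partial>\<mu>)"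
      using j \<delta> int by (intro integral_mono) auto
    also have "\<dots> = (\<integral>x. min (\<delta> * real j) x \<partial>\<mu>) + \<delta>" using int by (simp add: prob_space)
    also have "\<dots> \<le> f (\<delta> * real j) + \<delta>" using le by simp
    also have "f (\<delta> * real j) \<le> measure_pmf.expectation q (\<lambda>k. min \<theta> (\<delta> * real k))"
      unfolding grid[symmetric] using j fin by (intro expectation_mono_finite) auto
    finally show ?thesis using grid_law by simp
  qed
qed

text \<open>A finite nonempty family of independent sets has a maximal member, which is a basis, so
  the ground set is feasible.\<close>

lemma matroid_feasible_sets:
  assumes "matroid E \<I>"
  shows "feasible_sets E (feasible_family E \<I>)"
proof
  show "finite E" using assms by (simp add: matroid_def)
  show "feasible_family E \<I> \<subseteq> Pow E" by (auto simp: feasible_family_def)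
  have "finite \<I>" "{} \<in> \<I>" "\<I> \<subseteq> Pow E"
    using assms finite_subset[of \<I> "Pow E"] by (auto simp: matroid_def)
  then obtain B where "B \<in> \<I>" "\<forall>X\<in>\<I>. B \<subseteq> X \<longrightarrow> B = X"
    using finite_has_maximal2[of \<I> "{}"] by auto
  then show "E \<in> feasible_family E \<I>"
    using \<open>\<I> \<subseteq> Pow E\<close> by (auto simp: feasible_family_def basis_def)
qed

text \<open>The potential argument for the full game, with the weight of each MDP distributed
  according to the grid law of its current state.\<close>

lemma OPT_ge_grid:
  fixes M :: "nat \<Rightarrow> ('s, 'a) cimdp" and q :: "nat \<Rightarrow> 's \<Rightarrow> nat pmf"
  assumes inst: "matroid_min_cics n M \<I>" and \<delta>: "\<delta> > 0"
    and fin_q: "\<And>i s. finite (set_pmf (q i s))"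
    and grid: "\<And>i s j. i \<in> {1..n} \<Longrightarrow> s \<in> states (M i) \<Longrightarrow>
      measure_pmf.expectation (q i s) (\<lambda>k. min (\<delta> * real j) (\<delta> * real k)) = bellman (M i) s (\<delta> * real j)"
  shows "(\<integral>w. feasible_sets.completion_cost (feasible_family {1..n} \<I>) {} w
      \<partial>Pi\<^sub>M {1..n} (\<lambda>i. grid_law \<delta> (q i (start (M i))))) \<le> OPT n M \<I>"
proof -
  define E where "E = {1..n}"
  define \<F> where "\<F> = feasible_family E \<I>"
  have cim: "costly_mdp (M i)" if "i \<in> E" for i
    using inst that by (simp add: matroid_min_cics_def costly_mdp_def E_def)
  interpret feasible_sets E \<F>
    unfolding \<F>_def using inst by (intro matroid_feasible_sets) (simp add: matroid_min_cics_def E_def)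
  define law where "law x i = grid_law \<delta> (q i (x i))" for x i
  have law: "weight_law (law x i)" for x i unfolding law_def by (intro weight_law_grid_law fin_q)
  let ?G = "cics_game n M \<F>"
  define Inv where "Inv = {(x, S). S \<subseteq> E \<and> (\<forall>i\<in>E. x i \<in> states (M i))}"
  \<comment> \<open>Each unaccepted MDP contributes its height plus one unit for its
    acceptance.\<close>
  define rank where "rank = (\<lambda>(x, S). \<Sum>i\<in>E - S. Suc (costly_mdp.height (M i) (x i)))"
  \<comment> \<open>The product also carries laws for accepted elements, but
    \<open>completion_cost S\<close> does not read their weights.\<close>
  define \<Psi> where "\<Psi> = (\<lambda>(x, S). \<integral>w. completion_cost S w \<partial>Pi\<^sub>M E (law x))"
  have legalE: thesis
    if "(x, S) \<in> Inv" "m \<in> legal ?G (x, S)"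
      and adv: "\<And>i a. m = (i, Advance a) \<Longrightarrow> i \<in> E - S \<Longrightarrow> x i \<in> states (M i) \<Longrightarrow>
        x i \<notin> terminals (M i) \<Longrightarrow> a \<in> actions (M i) (x i) \<Longrightarrow> thesis"
      and acc: "\<And>i. m = (i, Accept) \<Longrightarrow> i \<in> E - S \<Longrightarrow> x i \<in> states (M i) \<Longrightarrow>
        x i \<in> terminals (M i) \<Longrightarrow> thesis"
    for x S m thesis
    using that by (auto simp: cics_game_def cics_legal_def acts_def Inv_def E_def split: if_splits)
  have rank_less: "rank c' < rank (x, S)"
    if "S \<subseteq> E" "i \<in> E - S" and c': "c' = (x, insert i S) \<or>
      (\<exists>s'. c' = (x(i := s'), S) \<and> costly_mdp.height (M i) s' < costly_mdp.height (M i) (x i))" for x S i c'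
  proof -
    have "rank (x, S) = Suc (costly_mdp.height (M i) (x i)) + (\<Sum>j\<in>E - S - {i}. Suc (costly_mdp.height (M j) (x j)))"
      unfolding rank_def using that(2) finite_E by (simp add: sum.remove[of "E - S" i])
    moreover have "rank (x, insert i S) = (\<Sum>j\<in>E - S - {i}. Suc (costly_mdp.height (M j) (x j)))"
      unfolding rank_def by (simp add: Diff_insert[symmetric])
    moreover have "rank (x(i := s'), S) =
        Suc (costly_mdp.height (M i) s') + (\<Sum>j\<in>E - S - {i}. Suc (costly_mdp.height (M j) (x j)))" for s'
      unfolding rank_def using that(2) finite_E
      by (auto simp: sum.remove[of "E - S" i] intro!: sum.cong)
    ultimately show ?thesis using c' by auto
  qed
  interpret bounded_game ?G Inv rank
  proof
    show "init ?G \<in> Inv"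
      using costly_mdp.start_state[OF cim] by (auto simp: cics_game_def Inv_def)
  next
    fix c assume "c \<in> Inv"
    moreover obtain x S where c: "c = (x, S)" by (cases c)
    ultimately have xS: "(x, S) \<in> Inv" by simp
    then have "legal ?G c \<subseteq> (SIGMA i:E. acts (M i) (x i))"
      by (auto simp: c cics_game_def cics_legal_def E_def)
    moreover have "finite (SIGMA i:E. acts (M i) (x i))"
      using xS costly_mdp.finite_acts[OF cim] finite_E by (auto simp: Inv_def)
    ultimately show "finite (legal ?G c)" by (rule finite_subset)
    fix m assume m: "m \<in> legal ?G c"
    show "finite (set_pmf (succ ?G c m))"
      using xS m[unfolded c]
      by (rule legalE) (auto simp: c cics_game_def cics_succ_def intro: costly_mdp.finite_trans[OF cim])
    fix c' assume c': "c' \<in> set_pmf (succ ?G c m)"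
    show "c' \<in> Inv \<and> rank c' < rank c"
      using xS m[unfolded c]
    proof (rule legalE)
      fix i assume "m = (i, Accept)" and i: "i \<in> E - S"
      with c' c have "c' = (x, insert i S)" by (simp add: cics_game_def cics_succ_def)
      with rank_less[of S i c' x] i xS show ?thesis by (auto simp: c Inv_def)
    next
      fix i a assume m: "m = (i, Advance a)" and i: "i \<in> E - S"
        and a: "x i \<in> states (M i)" "x i \<notin> terminals (M i)" "a \<in> actions (M i) (x i)"
      with c' c obtain s' where s': "c' = (x(i := s'), S)" "s' \<in> set_pmf (trans (M i) (x i) a)"
        by (auto simp: cics_game_def cics_succ_def)
      have M: "costly_mdp (M i)" using i cim by simp
      have "s' \<in> states (M i)" using costly_mdp.trans_states[OF M a] s'(2) by auto
      moreover have "costly_mdp.height (M i) s' < costly_mdp.height (M i) (x i)"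
        using costly_mdp.height_less[OF M costly_mdp.edgeI[OF M a s'(2)]] .
      ultimately show ?thesis using rank_less[of S i c' x] i xS s'(1) by (auto simp: c Inv_def)
    qed
  qed
  have "\<Psi> (init ?G) \<le> min_cost ?G"
  proof (rule min_cost_ge_potential)
    fix c assume "c \<in> Inv"
    moreover obtain x S where c: "c = (x, S)" by (cases c)
    ultimately have xS: "(x, S) \<in> Inv" by simp
    then have S: "S \<subseteq> E" by (simp add: Inv_def)
    {
      assume ended: "legal ?G c = {}"
      \<comment> \<open>A position without moves must be feasible: otherwise \<open>S\<close>
        differs from \<open>E\<close>, and some unaccepted MDP still has an available act.\<close>
      have "S \<in> \<F>"
      proof (rule ccontr)
        assume "S \<notin> \<F>"
        with E_feasible S have "S \<noteq> E" by blast
        with S obtain i where i: "i \<in> E - S" by blast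
        with xS costly_mdp.acts_nonempty[OF cim, of i "x i"] obtain \<alpha> where "\<alpha> \<in> acts (M i) (x i)"
          by (auto simp: Inv_def)
        with i \<open>S \<notin> \<F>\<close> have "(i, \<alpha>) \<in> legal ?G c"
          by (auto simp: c cics_game_def cics_legal_def E_def)
        with ended show False by simp
      qed
      then have "(\<integral>w. completion_cost S w \<partial>Pi\<^sub>M E (law x)) \<le> (\<integral>w. 0 \<partial>Pi\<^sub>M E (law x))"
        using integrable_completion_cost[OF law S] completion_cost_nonpos by (intro integral_mono) auto
      then show "\<Psi> c \<le> 0" by (simp add: \<Psi>_def c)
    }
    fix m assume m: "m \<in> legal ?G c"
    show "\<Psi> c \<le> price ?G c m + measure_pmf.expectation (succ ?G c m) \<Psi>"
      using xS m[unfolded c]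
    proof (rule legalE)
      fix i assume m: "m = (i, Accept)" and i: "i \<in> E - S"
        and t: "x i \<in> states (M i)" "x i \<in> terminals (M i)"
      have M: "costly_mdp (M i)" using i cim by simp
      \<comment> \<open>At a terminal state every capped mean is a minimum with the mean value, so
        the mean of the grid law does not exceed the price of acceptance.\<close>
      have "measure_pmf.expectation (q i (x i)) (\<lambda>k. \<delta> * real k) \<le> mean_val (M i) (x i)"
        using grid[of i "x i"] i t(1) costly_mdp.bellman_terminal[OF M t(2)]
        by (intro grid_mean_le[OF \<delta> fin_q]) (simp add: E_def)
      then have "(\<integral>u. u \<partial>law x i) \<le> mean_val (M i) (x i)"
        unfolding law_def by (subst integral_grid_law) simp_all
      moreover have "(\<integral>w. w i \<partial>Pi\<^sub>M E (law x)) = (\<integral>u. u \<partial>law x i)"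
      proof -
        have "(\<integral>u. u \<partial>distr (Pi\<^sub>M E (law x)) (law x i) (\<lambda>w. w i)) = (\<integral>w. w i \<partial>Pi\<^sub>M E (law x))"
          using i by (intro integral_distr weight_law_measurable[OF law]) auto
        moreover have "distr (Pi\<^sub>M E (law x)) (law x i) (\<lambda>w. w i) = law x i"
          using i law by (intro distr_PiM_component) (auto simp: weight_law_def)
        ultimately show ?thesis by simp
      qed
      moreover have "(\<integral>w. completion_cost S w \<partial>Pi\<^sub>M E (law x)) \<le>
          (\<integral>w. w i + completion_cost (insert i S) w \<partial>Pi\<^sub>M E (law x))"
        using S i completion_cost_insert
        by (intro integral_mono Bochner_Integration.integrable_add integrable_PiM_coordinate
            integrable_completion_cost law) auto
      moreover have "(\<integral>w. w i + completion_cost (insert i S) w \<partial>Pi\<^sub>M E (law x)) =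
          (\<integral>w. w i \<partial>Pi\<^sub>M E (law x)) + (\<integral>w. completion_cost (insert i S) w \<partial>Pi\<^sub>M E (law x))"
        using S i by (intro Bochner_Integration.integral_add integrable_PiM_coordinate
            integrable_completion_cost law) auto
      ultimately show ?thesis
        by (simp add: \<Psi>_def c m cics_game_def cics_price_def cics_succ_def)
    next
      fix i a assume m: "m = (i, Advance a)" and i: "i \<in> E - S"
        and a: "x i \<in> states (M i)" "x i \<notin> terminals (M i)" "a \<in> actions (M i) (x i)"
      have M: "costly_mdp (M i)" using i cim by simp
      let ?p = "trans (M i) (x i) a"
      have fin: "finite (set_pmf ?p)" by (rule costly_mdp.finite_trans[OF M a])
      \<comment> \<open>A transition of one MDP changes exactly one factor of the product
        measure.\<close>
      have law_upd: "law (x(i := s')) = (law x)(i := grid_law \<delta> (q i s'))" for s'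
        by (auto simp: law_def)
      \<comment> \<open>This is the Bellman inequality for action \<open>a\<close>, read at grid
        points, where the capped means agree with the Bellman values.\<close>
      have grid_dom: "measure_pmf.expectation (q i (x i)) (\<lambda>k. min (\<delta> * real j) (\<delta> * real k)) \<le>
          cost (M i) a + measure_pmf.expectation ?p
            (\<lambda>s'. measure_pmf.expectation (q i s') (\<lambda>k. min (\<delta> * real j) (\<delta> * real k)))" for j
      proof -
        have "measure_pmf.expectation ?p
            (\<lambda>s'. measure_pmf.expectation (q i s') (\<lambda>k. min (\<delta> * real j) (\<delta> * real k))) =
            measure_pmf.expectation ?p (\<lambda>s'. bellman (M i) s' (\<delta> * real j))"
          using i costly_mdp.trans_states[OF M a] by (intro expectation_cong_set_pmf grid) (auto simp: E_def)
        with costly_mdp.bellman_le_advance[OF M a, of "\<delta> * real j"] grid[of i "x i" j] i a(1)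
        show ?thesis by (simp add: E_def)
      qed
      have "(\<integral>w. completion_cost S w \<partial>Pi\<^sub>M E (law x)) \<le> cost (M i) a +
          measure_pmf.expectation ?p
            (\<lambda>s'. \<integral>w. completion_cost S w \<partial>Pi\<^sub>M E ((law x)(i := grid_law \<delta> (q i s'))))"
      proof (rule replace_coordinate[OF law weight_law_grid_law[OF fin_q] fin S i])
        fix \<theta>
        show "(\<integral>u. min \<theta> u \<partial>law x i) \<le> cost (M i) a +
            measure_pmf.expectation ?p (\<lambda>s'. \<integral>u. min \<theta> u \<partial>grid_law \<delta> (q i s'))"
          unfolding law_def
          using grid_domination[OF \<delta> costly_mdp.cost_nonneg[OF M a] fin_q fin fin_q grid_dom]
          by (subst (1 2) integral_grid_law) simp_all
      qed
      then show ?thesis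
        by (simp add: \<Psi>_def c m cics_game_def cics_price_def cics_succ_def law_upd)
    qed
  qed
  then show ?thesis
    by (simp add: OPT_def \<Psi>_def cics_game_def law_def[abs_def] \<F>_def E_def)
qed

theorem theorem2:
  fixes n :: nat and M :: "nat \<Rightarrow> ('s, 'a) cimdp" and \<I> :: "nat set set"
    and P :: "'w measure" and W :: "nat \<Rightarrow> 'w \<Rightarrow> real"
  assumes "matroid_min_cics n M \<I>"
    and "prob_space P"
    and "\<And>i. i \<in> {1..n} \<Longrightarrow> surrogate_cost P (W i) (M i)"
    and "prob_space.indep_vars P (\<lambda>_. borel) W {1..n}"
  shows "OPT n M \<I> \<ge>
    prob_space.expectation P (\<lambda>\<omega>. Min ((\<lambda>S. \<Sum>i\<in>S. W i \<omega>) ` feasible_family {1..n} \<I>))"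
proof -
  define E where "E = {1..n}"
  define \<F> where "\<F> = feasible_family E \<I>"
  interpret prob_space P by fact
  have cim: "costly_mdp (M i)" if "i \<in> E" for i
    using assms(1) that by (simp add: matroid_min_cics_def costly_mdp_def E_def)
  interpret feasible_sets E \<F>
    unfolding \<F>_def using assms(1) by (intro matroid_feasible_sets) (simp add: matroid_min_cics_def E_def)
  have W_meas: "random_variable borel (W i)" if "i \<in> E" for i
    using assms(3) that by (simp add: surrogate_cost_def E_def)
  have W_min: "integrable P (\<lambda>\<omega>. min y (W i \<omega>))"
    "expectation (\<lambda>\<omega>. min y (W i \<omega>)) \<le> bellman (M i) (start (M i)) y" if "i \<in> E" for i y
    using assms(3)[of i] that costly_mdp.local_opt_le_bellman[OF cim[OF that], of y]
    by (auto simp: surrogate_cost_def E_def)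
  have W_int: "integrable P (W i)" if i: "i \<in> E" for i
  proof -
    obtain C where "\<forall>y. bellman (M i) (start (M i)) y \<le> C"
      using costly_mdp.bellman_stabilises[OF cim[OF i] costly_mdp.start_state[OF cim[OF i]]] by blast
    then have "expectation (\<lambda>\<omega>. min y (W i \<omega>)) \<le> C" for y
      using W_min(2)[OF i] order_trans by blast
    then show ?thesis by (rule integrable_if_capped_means_bounded[OF W_meas[OF i] W_min(1)[OF i]])
  qed
  \<comment> \<open>The point mass at 0 is a default outside \<open>E\<close>, so that every index
    carries a weight law.\<close>
  define \<mu> where "\<mu> i = (if i \<in> E then distr P borel (W i) else return borel 0)" for i
  have \<mu>: "weight_law (\<mu> i)" for i
    using W_int W_meas prob_space_distr
    by (auto simp: \<mu>_def weight_law_def integrable_distr_eq prob_space_return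
        intro!: finite_measure.integrable_const_bound[where B = 0]
        prob_space.finite_measure simp: AE_return)
  have \<mu>_min: "(\<integral>x. min \<theta> x \<partial>\<mu> i) \<le> bellman (M i) (start (M i)) \<theta>" if "i \<in> E" for i \<theta>
    using W_min(2)[OF that] W_meas[OF that] that by (simp add: \<mu>_def integral_distr)
  \<comment> \<open>Independence identifies the joint law of the surrogate costs with the product of
    their marginals. The empty index set is treated apart: there the completion cost is
    constant.\<close>
  have value_eq: "expectation (\<lambda>\<omega>. Min ((\<lambda>S. \<Sum>i\<in>S. W i \<omega>) ` \<F>)) =
      (\<integral>w. completion_cost {} w \<partial>Pi\<^sub>M E \<mu>)"
  proof -
    have "expectation (\<lambda>\<omega>. Min ((\<lambda>S. \<Sum>i\<in>S. W i \<omega>) ` \<F>)) =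
        expectation (\<lambda>\<omega>. completion_cost {} (\<lambda>i. W i \<omega>))"
      by (simp add: completion_cost_def)
    also have "\<dots> = (\<integral>w. completion_cost {} w \<partial>Pi\<^sub>M E \<mu>)"
    proof (cases "E = {}")
      case True
      then have const: "completion_cost {} = (\<lambda>_. completion_cost {} (\<lambda>_. 0))"
        by (intro ext completion_cost_cong) auto
      interpret Pi: prob_space "Pi\<^sub>M E \<mu>"
        using \<mu> by (intro prob_space_PiM) (simp add: weight_law_def)
      show ?thesis by (subst (1 2) const) (simp add: prob_space Pi.prob_space)
    next
      case False
      have "distr P (\<Pi>\<^sub>M i\<in>E. borel) (\<lambda>\<omega>. \<lambda>i\<in>E. W i \<omega>) = (\<Pi>\<^sub>M i\<in>E. distr P borel (W i))"
        using indep_vars_iff_distr_eq_PiM'[OF False, of W "\<lambda>_. borel"] W_meas assms(4)[folded E_def] by simp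
      also have "\<dots> = Pi\<^sub>M E \<mu>" by (intro PiM_cong) (auto simp: \<mu>_def)
      finally have "(\<integral>w. completion_cost {} w \<partial>Pi\<^sub>M E \<mu>) =
          (\<integral>w. completion_cost {} w \<partial>distr P (\<Pi>\<^sub>M i\<in>E. borel) (\<lambda>\<omega>. \<lambda>i\<in>E. W i \<omega>))" by simp
      also have "\<dots> = expectation (\<lambda>\<omega>. completion_cost {} (\<lambda>i\<in>E. W i \<omega>))"
        using W_meas by (intro integral_distr measurable_restrict completion_cost_measurable) auto
      also have "\<dots> = expectation (\<lambda>\<omega>. completion_cost {} (\<lambda>i. W i \<omega>))"
        by (intro Bochner_Integration.integral_cong refl completion_cost_cong) simp
      finally show ?thesis by simp
    qed
    finally show ?thesis .
  qed
  have approx: "(\<integral>w. completion_cost {} w \<partial>Pi\<^sub>M E \<mu>) \<le> OPT n M \<I> + \<delta> * real n" if \<delta>: "\<delta> > 0" for \<delta>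
  proof -
    have "\<exists>q :: nat pmf. finite (set_pmf q) \<and> (i \<in> E \<longrightarrow> s \<in> states (M i) \<longrightarrow>
      (\<forall>j. measure_pmf.expectation q (\<lambda>k. min (\<delta> * real j) (\<delta> * real k)) = bellman (M i) s (\<delta> * real j)))"
      for i s
    proof (cases "i \<in> E \<and> s \<in> states (M i)")
      case True
      then have M: "costly_mdp (M i)" and s: "s \<in> states (M i)" using cim by auto
      obtain K C where "\<forall>y. K \<le> y \<longrightarrow> bellman (M i) s y = C"
        using costly_mdp.bellman_stabilises[OF M s] by blast
      then show ?thesis
        using exists_grid_pmf[OF \<delta> costly_mdp.bellman_eq_nonpos[OF M s] costly_mdp.bellman_midpoint_concave[OF M s]]
        by blast
    next
      case False
      \<comment> \<open>An arbitrary finitely supported law keeps the choice function total.\<close>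
      then show ?thesis by (intro exI[of _ "return_pmf 0"]) auto
    qed
    then obtain q :: "nat \<Rightarrow> 's \<Rightarrow> nat pmf" where q: "\<And>i s. finite (set_pmf (q i s))"
      "\<And>i s j. i \<in> E \<Longrightarrow> s \<in> states (M i) \<Longrightarrow>
        measure_pmf.expectation (q i s) (\<lambda>k. min (\<delta> * real j) (\<delta> * real k)) = bellman (M i) s (\<delta> * real j)"
      by metis
    define \<nu> where "\<nu> i = grid_law \<delta> (q i (start (M i)))" for i
    have \<nu>: "weight_law (\<nu> i)" for i unfolding \<nu>_def by (intro weight_law_grid_law q)
    \<comment> \<open>Here \<open>A\<close> is the set of coordinates already switched to grid laws;
      each switch costs at most \<delta>.\<close>
    have hybrid: "(\<integral>w. completion_cost {} w \<partial>Pi\<^sub>M E \<mu>) \<le> \<delta> * real (card A) +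
        (\<integral>w. completion_cost {} w \<partial>Pi\<^sub>M E (\<lambda>i. if i \<in> A then \<nu> i else \<mu> i))" if "A \<subseteq> E" for A
      using finite_subset[OF that finite_E] that
    proof (induction A rule: finite_induct)
      case empty
      then show ?case by simp
    next
      case (insert i A)
      let ?\<mu> = "\<lambda>i. if i \<in> A then \<nu> i else \<mu> i"
      have i: "i \<in> E" using insert by simp
      \<comment> \<open>A plain exchange of laws is a mixture over a single point, with the error
        \<delta> in the role of the action cost.\<close>
      have "(\<integral>w. completion_cost {} w \<partial>Pi\<^sub>M E ?\<mu>) \<le> \<delta> + measure_pmf.expectation (return_pmf ())
          (\<lambda>_. \<integral>w. completion_cost {} w \<partial>Pi\<^sub>M E (?\<mu>(i := \<nu> i)))"
      proof (rule replace_coordinate)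
        show "(\<integral>x. min \<theta> x \<partial>?\<mu> i) \<le>
            \<delta> + measure_pmf.expectation (return_pmf ()) (\<lambda>_. \<integral>x. min \<theta> x \<partial>\<nu> i)" for \<theta>
          using grid_law_approximates[OF \<delta> q(1) \<mu> \<mu>_min[OF i] q(2)[OF i costly_mdp.start_state[OF cim[OF i]]]]
            insert.hyps by (simp add: \<nu>_def)
      qed (use i \<mu> \<nu> in auto)
      also have "?\<mu>(i := \<nu> i) = (\<lambda>j. if j \<in> insert i A then \<nu> j else \<mu> j)" by auto
      finally show ?case using insert by (simp add: algebra_simps)
    qed
    have "(\<integral>w. completion_cost {} w \<partial>Pi\<^sub>M E (\<lambda>i. if i \<in> E then \<nu> i else \<mu> i)) =
        (\<integral>w. completion_cost {} w \<partial>Pi\<^sub>M E \<nu>)"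
      by (intro arg_cong[where f = "\<lambda>N. \<integral>w. completion_cost {} w \<partial>N"] PiM_cong) auto
    also have "\<dots> \<le> OPT n M \<I>"
      unfolding \<nu>_def \<F>_def E_def by (rule OPT_ge_grid[OF assms(1) \<delta> q(1) q(2)[unfolded E_def]])
    finally show ?thesis using hybrid[of E] by (simp add: E_def)
  qed
  have "(\<integral>w. completion_cost {} w \<partial>Pi\<^sub>M E \<mu>) \<le> OPT n M \<I>"
  proof (rule field_le_epsilon)
    fix e :: real assume e: "e > 0"
    \<comment> \<open>Dividing by \<open>Suc n\<close> keeps the grid width positive and well
      defined also when \<open>n\<close> is 0.\<close>
    have "e / real (Suc n) * real n \<le> e" using e by (simp add: field_simps)
    with approx[of "e / real (Suc n)"] e
    show "(\<integral>w. completion_cost {} w \<partial>Pi\<^sub>M E \<mu>) \<le> OPT n M \<I> + e" by simp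
  qed
  then show ?thesis using value_eq by (simp add: \<F>_def E_def)
qed

end
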